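(* Let $\gamma>0$ and consider a spike configuration $(\ell_i)_{i=1}^r$ with $1\le\ell_r<\ell_{r-1}<\dots<\ell_1$. Put $\lambda_1=\lambda(\ell_1;\gamma)$ and let $\eta_m^*(\cdot)=\eta_m^*(\cdot;\lambda_1,\gamma)$ be the nonlinearity given in item 3 (identically $1$ when $\ell_1\le\ell_1^+(\gamma)$). 1. (Optimal asymptotic pivot.) For every $p>2r$, $$\kappa\big(\Delta^a((\ell_i);(\eta_m^*(\lambda(\ell_i)))_{i=1}^r)\big)=\min_{(\eta_i)_{i=1}^r\in(0,\infty)^r}\kappa\big(\Delta^a((\ell_i);(\eta_i)_{i=1}^r)\big).$$ 2. (Optimal asymptotic loss.) $\kappa\big(\Delta^a((\ell_i);(\eta_m^*(\lambda(\ell_i)))_{i=1}^r)\big)=\kappa_1^*(\ell_1;\gamma)$. 3. (Optimal shrinkage formula.) Suppose $\ell_1>\ell_1^+(\gamma)$, let $\nu_-^{1,*}=\nu_-(A(\ell_1,\eta_1^*(\lambda(\ell_1));\gamma))$, define $\ell^+_{\eta_m^*}(\ell_1,\gamma)=1/\nu_-^{1,*}$, and set $a=c^2/\ell+s^2$, $b=s^2/\ell+c^2$. Then $\nu_-^{1,*}\ne1/(a\ell)$ and the optimal multi-spike shrinker is $$\eta_m^*(\lambda(\ell))=\begin{cases}\dfrac{\nu_-^{1,*}-b}{a-1/(\ell\cdot\nu_-^{1,*})},&\ell>\ell^+_{\eta_m^*},\\[2mm]1,&\ell\le\ell^+_{\eta_m^*}.\end{cases}$$ 4. (Collapse of the bulk.)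 Let $\lambda^+_{\eta_m^*}=\lambda(\ell^+_{\eta_m^*}(\ell_1,\gamma);\gamma)$, where $\ell^+_{\eta_m^*}(\ell_1,\gamma)=1/\nu_-^{1,*}$. For each $\lambda_1>\lambda_+(\gamma)$ we have $\lambda^+_{\eta_m^*}>\lambda_+(\gamma)$, so $\eta_m^*(\cdot;\lambda_1)$ collapses the vicinity of the bulk to $1$: there is $\epsilon>0$ such that $\eta_m^*(\lambda;\lambda_1,\gamma)=1$ whenever $\lambda<\lambda_+(\gamma)+\epsilon$.
   Context: $\kappa$ denotes condition number; $\nu_-(A)\le\nu_+(A)$ are the eigenvalues of a symmetric $2\times2$ matrix. $\ell_+(\gamma)=1+\sqrt\gamma$, $\lambda_+(\gamma)=(1+\sqrt\gamma)^2$; $\lambda(\ell)=\lambda(\ell;\gamma)=\ell(1+\frac{\gamma}{\ell-1})$ for $\ell>\ell_+(\gamma)$ and $\lambda_+(\gamma)$ for $\ell\le\ell_+(\gamma)$; for $\lambda>\lambda_+(\gamma)$ the inverse is $\ell(\lambda;\gamma)=\frac{\lambda+1-\gamma+\sqrt{(\lambda+1-\gamma)^2-4\lambda}}{2}$. $c=c(\ell;\gamma)=\sqrt{\frac{1-\gamma/(\ell-1)^2}{1+\gamma/(\ell-1)}}$ for $\ell>\ell_+(\gamma)$, $c=0$ for $\ell\le\ell_+(\gamma)$; $s=\sqrt{1-c^2}$. $$A(\ell,\eta;\gamma)=\begin{bmatrix}\frac{\eta c^2+s^2}{\ell}&\frac{(\eta-1)cs}{\sqrt\ell}\\ \frac{(\eta-1)cs}{\sqrt\ell}&c^2+\eta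 s^2\end{bmatrix}.$$ Asymptotic pivot ($p\times p$, $p>2r$): $\Delta^a((\ell_i);(\eta_i)_{i=1}^r)=\bigoplus_{i=1}^rA(\ell_i,\eta_i;\gamma)\oplus I_{p-2r}$. $\ell_1^+(\gamma)=1+(\gamma+\sqrt{\gamma^2+8\gamma})/2$. Single-spike nonlinearity: $\eta_1^*(\lambda)=\frac{\ell}{1+\gamma+2\gamma/(\ell-1)}$ with $\ell=\ell(\lambda;\gamma)$ if $\lambda>\lambda_+(\gamma)$ and $\ell(\lambda;\gamma)>\ell_1^+(\gamma)$; $\eta_1^*(\lambda)=1$ otherwise. $\kappa_1^*(\ell;\gamma)=\kappa(A(\ell,\eta_1^*(\lambda(\ell));\gamma))$. For $\lambda\le\lambda_+(\gamma)$ the convention is $\eta_m^*(\lambda;\lambda_1,\gamma)=1$. In item 4, $\nu_-^{1,*}$ is defined by the same formula $\nu_-(A(\ell_1,\eta_1^*(\lambda(\ell_1));\gamma))$ for every $\ell_1>\ell_+(\gamma)$. *)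

theory Defs
  imports Complex_Main "Jordan_Normal_Form.Char_Poly"
begin

(* Over the reals, eigenvalue only sees real eigenvalues; this loses nothing for the symmetric
   matrix transpose_mat A * A, whose eigenvalues are all real and nonnegative. *)
definition singular_values :: "real mat \<Rightarrow> real set" where
  "singular_values A = {sqrt \<mu> |\<mu>. eigenvalue (transpose_mat A * A) \<mu>}"

(* Meaningful for invertible A only: a singular A would get the value 0 (division by 0)
   instead of infinity. *)
definition condition_number :: "real mat \<Rightarrow> real" where
  "condition_number A = Max (singular_values A) / Min (singular_values A)"

definition nu_minus :: "real mat \<Rightarrow> real" where
  "nu_minus A = Min {\<nu>. eigenvalue A \<nu>}"

definition ell_plus :: "real \<Rightarrow> real" where
  "ell_plus \<gamma> = 1 + sqrt \<gamma>"

definition lambda_plus :: "real \<Rightarrow> real" where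
  "lambda_plus \<gamma> = (1 + sqrt \<gamma>)\<^sup>2"

definition lambda_of :: "real \<Rightarrow> real \<Rightarrow> real" where
  "lambda_of l \<gamma> =
     (if l > ell_plus \<gamma> then l * (1 + \<gamma> / (l - 1)) else lambda_plus \<gamma>)"

(* Inverse of lambda_of; used only for lam > lambda_plus \<gamma>. *)
definition ell_of :: "real \<Rightarrow> real \<Rightarrow> real" where
  "ell_of lam \<gamma> = (lam + 1 - \<gamma> + sqrt ((lam + 1 - \<gamma>)\<^sup>2 - 4 * lam)) / 2"

definition cos_of :: "real \<Rightarrow> real \<Rightarrow> real" where
  "cos_of l \<gamma> =
     (if l > ell_plus \<gamma> then sqrt ((1 - \<gamma> / (l - 1)\<^sup>2) / (1 + \<gamma> / (l - 1))) else 0)"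

definition sin_of :: "real \<Rightarrow> real \<Rightarrow> real" where
  "sin_of l \<gamma> = sqrt (1 - (cos_of l \<gamma>)\<^sup>2)"

definition A_mat :: "real \<Rightarrow> real \<Rightarrow> real \<Rightarrow> real mat" where
  "A_mat l \<eta> \<gamma> =
     (let c = cos_of l \<gamma>; s = sin_of l \<gamma> in
      mat_of_rows_list 2
        [[(\<eta> * c\<^sup>2 + s\<^sup>2) / l,      (\<eta> - 1) * c * s / sqrt l],
         [(\<eta> - 1) * c * s / sqrt l,  c\<^sup>2 + \<eta> * s\<^sup>2]])"

(* The p x p asymptotic pivot (for p > 2 r); only the entries 1, ..., r of ell and \<eta> are used. *)
definition asymp_pivot ::
    "nat \<Rightarrow> nat \<Rightarrow> (nat \<Rightarrow> real) \<Rightarrow> (nat \<Rightarrow> real) \<Rightarrow> real \<Rightarrow> real mat" where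
  "asymp_pivot p r ell \<eta> \<gamma> =
     diag_block_mat (map (\<lambda>i. A_mat (ell i) (\<eta> i) \<gamma>) [1..<Suc r] @ [1\<^sub>m (p - 2 * r)])"

definition ell1_plus :: "real \<Rightarrow> real" where
  "ell1_plus \<gamma> = 1 + (\<gamma> + sqrt (\<gamma>\<^sup>2 + 8 * \<gamma>)) / 2"

definition eta1 :: "real \<Rightarrow> real \<Rightarrow> real" where
  "eta1 lam \<gamma> =
     (let l = ell_of lam \<gamma> in
      if lam > lambda_plus \<gamma> \<and> l > ell1_plus \<gamma>
      then l / (1 + \<gamma> + 2 * \<gamma> / (l - 1)) else 1)"

definition kappa1 :: "real \<Rightarrow> real \<Rightarrow> real" where
  "kappa1 l \<gamma> = condition_number (A_mat l (eta1 (lambda_of l \<gamma>) \<gamma>) \<gamma>)"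

definition nu1_minus :: "real \<Rightarrow> real \<Rightarrow> real" where
  "nu1_minus l1 \<gamma> = nu_minus (A_mat l1 (eta1 (lambda_of l1 \<gamma>) \<gamma>) \<gamma>)"

definition ell_m_plus :: "real \<Rightarrow> real \<Rightarrow> real" where
  "ell_m_plus l1 \<gamma> = 1 / nu1_minus l1 \<gamma>"

definition coef_a :: "real \<Rightarrow> real \<Rightarrow> real" where
  "coef_a l \<gamma> = (cos_of l \<gamma>)\<^sup>2 / l + (sin_of l \<gamma>)\<^sup>2"

definition coef_b :: "real \<Rightarrow> real \<Rightarrow> real" where
  "coef_b l \<gamma> = (sin_of l \<gamma>)\<^sup>2 / l + (cos_of l \<gamma>)\<^sup>2"

(* The multi-spike nonlinearity as a function of the empirical eigenvalue lam, with the top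
   empirical eigenvalue lam1 as parameter. It is identically 1 unless lam1 comes from a spike
   l1 > ell1_plus \<gamma>, and is 1 for lam \<le> lambda_plus \<gamma>, where ell_of is not an inverse.
   The value in the first branch solves det (A_mat l eta \<gamma> - nu I) = 0 for eta, with nu the smaller
   eigenvalue of the optimally shrunk top block. *)
definition eta_m :: "real \<Rightarrow> real \<Rightarrow> real \<Rightarrow> real" where
  "eta_m lam lam1 \<gamma> =
     (let l = ell_of lam \<gamma>; l1 = ell_of lam1 \<gamma>; \<nu> = nu1_minus l1 \<gamma> in
      if lam1 > lambda_plus \<gamma> \<and> l1 > ell1_plus \<gamma> \<and>
         lam > lambda_plus \<gamma> \<and> l > ell_m_plus l1 \<gamma>
      then (\<nu> - coef_b l \<gamma>) / (coef_a l \<gamma> - 1 / (l * \<nu>)) else 1)"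

end

theory Submission
  imports Defs
begin

text \<open>
  A block with trace \<open>\<eta> a + b\<close> and determinant \<open>\<eta> / l\<close> has condition number bounded below, by AM-GM,
  in terms of \<open>4 a b l\<close>, with equality at \<open>\<eta> = b / a\<close>; when \<open>b \<le> a\<close> the eigenvalue 1 of the identity
  block pushes the optimum to \<open>\<eta> = 1\<close>. This gives the lower bound through the top spike alone.
  Conversely, let \<open>\<nu> \<le> \<mu>\<close> be the eigenvalues of the optimal top block. A lower spike with \<open>l \<le> 1 / \<nu>\<close>
  is left alone (eigenvalues \<open>1 / l, 1\<close>), and for \<open>l > 1 / \<nu>\<close> one solves for the \<open>\<eta>\<close> that makes \<open>\<nu>\<close>
  an eigenvalue; the other eigenvalue is then a Moebius function of \<open>l\<close> that increases from 1 at
  \<open>l = 1 / \<nu>\<close> to \<open>\<mu>\<close> at the top spike. So all spectra lie in \<open>[\<nu>, \<mu>]\<close>. That the Moebius function has no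
  pole, and that the bulk collapses, both come from the bounds \<open>1 / \<nu> > 1 + \<gamma>\<close> and
  \<open>1 / \<nu> > 1 + sqrt \<gamma>\<close>.
\<close>

subsection \<open>Singular values of block diagonal matrices\<close>

lemma det_2x2:
  fixes A :: "'a :: idom mat"
  assumes A: "A \<in> carrier_mat 2 2"
  shows "det A = A $$ (0,0) * A $$ (1,1) - A $$ (0,1) * A $$ (1,0)"
proof -
  let ?b = "\<lambda>i j. mat 1 1 (\<lambda>_. A $$ (i,j))"
  have "A = four_block_mat (?b 0 0) (?b 0 1) (?b 1 0) (?b 1 1)"
    by (rule eq_matI) (use A in \<open>auto simp: numeral_2_eq_2 less_Suc_eq\<close>)
  moreover have "det (four_block_mat (?b 0 0) (?b 0 1) (?b 1 0) (?b 1 1))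
      = det (?b 0 0 * ?b 1 1 - ?b 0 1 * ?b 1 0)"
    by (rule det_four_block_mat[of _ 1]) (auto simp: scalar_prod_def mult.commute)
  moreover have "det (?b 0 0 * ?b 1 1 - ?b 0 1 * ?b 1 0) =
      A $$ (0,0) * A $$ (1,1) - A $$ (0,1) * A $$ (1,0)"
    by (subst det_single) (auto simp: scalar_prod_def)
  ultimately show ?thesis
    by simp
qed

lemma eigenvalue_2x2_iff:
  fixes A :: "'a :: field mat"
  assumes A: "A \<in> carrier_mat 2 2"
  shows "eigenvalue A k \<longleftrightarrow>
    (A $$ (0,0) - k) * (A $$ (1,1) - k) - A $$ (0,1) * A $$ (1,0) = 0"
proof -
  have "det (char_matrix A k) =
      (A $$ (0,0) - k) * (A $$ (1,1) - k) - A $$ (0,1) * A $$ (1,0)"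
    by (subst det_2x2) (use A in \<open>auto simp: char_matrix_def\<close>)
  then show ?thesis
    unfolding eigenvalue_det[OF A] by simp
qed

lemma eigenvalue_one_mat_iff:
  "eigenvalue (1\<^sub>m n :: 'a :: field mat) k \<longleftrightarrow> n > 0 \<and> k = 1"
proof -
  have "char_matrix (1\<^sub>m n) k = (1 - k) \<cdot>\<^sub>m (1\<^sub>m n)"
    by (rule eq_matI) (auto simp: char_matrix_def)
  then show ?thesis
    by (subst eigenvalue_det[of _ n]) (auto simp: det_smult)
qed

lemma eigenvalue_four_block_diag_iff:
  fixes A B :: "'a :: field mat"
  assumes A: "A \<in> carrier_mat n n" and B: "B \<in> carrier_mat m m"
  shows "eigenvalue (four_block_mat A (0\<^sub>m n m) (0\<^sub>m m n) B) k \<longleftrightarrow>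
    eigenvalue A k \<or> eigenvalue B k"
proof -
  let ?M = "four_block_mat A (0\<^sub>m n m) (0\<^sub>m m n) B"
  have M: "?M \<in> carrier_mat (n + m) (n + m)"
    using A B by auto
  have "char_matrix ?M k =
      four_block_mat (char_matrix A k) (0\<^sub>m n m) (0\<^sub>m m n) (char_matrix B k)"
    by (rule eq_matI) (use A B in \<open>auto simp: char_matrix_def\<close>)
  then have "det (char_matrix ?M k) = det (char_matrix A k) * det (char_matrix B k)"
    using det_four_block_mat_lower_left_zero[of "char_matrix A k" n "0\<^sub>m n m" m "0\<^sub>m m n" "char_matrix B k"] A B
    by auto
  then show ?thesis
    unfolding eigenvalue_det[OF A] eigenvalue_det[OF B] eigenvalue_det[OF M] by simp
qed

lemma singular_values_four_block_diag:
  assumes A: "A \<in> carrier_mat n n" and B: "B \<in> carrier_mat m m"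
  shows "singular_values (four_block_mat A (0\<^sub>m n m) (0\<^sub>m m n) B) =
    singular_values A \<union> singular_values B"
proof -
  let ?M = "four_block_mat A (0\<^sub>m n m) (0\<^sub>m m n) B"
  have T: "transpose_mat ?M = four_block_mat (transpose_mat A) (0\<^sub>m n m) (0\<^sub>m m n) (transpose_mat B)"
    using transpose_four_block_mat[OF A, of "0\<^sub>m n m" m "0\<^sub>m m n" m B] B by simp
  have "transpose_mat ?M * ?M =
      four_block_mat (transpose_mat A * A) (0\<^sub>m n m) (0\<^sub>m m n) (transpose_mat B * B)"
    unfolding T by (subst mult_four_block_mat[of _ n n _ m _ m]) (use A B in auto)
  moreover have "transpose_mat A * A \<in> carrier_mat n n" "transpose_mat B * B \<in> carrier_mat m m"
    using A B by auto
  ultimately show ?thesis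
    by (auto simp: singular_values_def eigenvalue_four_block_diag_iff)
qed

lemma singular_values_one_mat:
  assumes "n > 0"
  shows "singular_values (1\<^sub>m n) = {1}"
  using assms by (auto simp: singular_values_def eigenvalue_one_mat_iff)

lemma singular_values_diag_block_mat:
  assumes "\<And>A. A \<in> set As \<Longrightarrow> square_mat A"
  shows "singular_values (diag_block_mat As) = (\<Union>A\<in>set As. singular_values A)"
  using assms
proof (induct As)
  case Nil
  \<comment> \<open>The empty block matrix is 0 x 0 and has no eigenvalue at all, which matches the
    union over no blocks.\<close>
  have "\<not> eigenvalue (0\<^sub>m 0 0 :: real mat) k" for k
    using eigenvalue_imp_nonzero_dim[of "0\<^sub>m 0 0 :: real mat" 0 k] by auto
  moreover have "transpose_mat (0\<^sub>m 0 0) * 0\<^sub>m 0 0 = (0\<^sub>m 0 0 :: real mat)"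
    by auto
  ultimately show ?case
    by (simp add: singular_values_def)
next
  case (Cons A As)
  let ?B = "diag_block_mat As"
  have "square_mat ?B"
    using Cons by (intro diag_block_mat_square) auto
  then have B: "?B \<in> carrier_mat (dim_row ?B) (dim_row ?B)" and dB: "dim_col ?B = dim_row ?B"
    by auto
  have A: "A \<in> carrier_mat (dim_row A) (dim_row A)" and dA: "dim_col A = dim_row A"
    using Cons.prems[of A] by auto
  have "singular_values (diag_block_mat (A # As)) = singular_values A \<union> singular_values ?B"
    unfolding diag_block_mat.simps Let_def dA dB by (rule singular_values_four_block_diag[OF A B])
  then show ?case
    using Cons by auto
qed

section \<open>Spectrum of a symmetric 2x2 matrix from its trace and determinant\<close>

context
  fixes A :: "real mat" and p q :: real
  assumes A: "A \<in> carrier_mat 2 2" and sym: "A $$ (0,1) = A $$ (1,0)"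
    and tr: "A $$ (0,0) + A $$ (1,1) = p + q"
    and dt: "A $$ (0,0) * A $$ (1,1) - (A $$ (1,0))\<^sup>2 = p * q"
begin

text \<open>Trace and determinant fix the characteristic polynomial, which factors as (k - p)(k -
  q). Prescribing the roots keeps square roots out of later calculations.\<close>

lemma eigenvalue_sym_2x2_iff: "eigenvalue A k \<longleftrightarrow> k = p \<or> k = q"
proof -
  have "(A $$ (0,0) - k) * (A $$ (1,1) - k) - A $$ (0,1) * A $$ (1,0) = (k - p) * (k - q)"
  proof -
    have *: "(w - k) * (x - k) - y * y = k\<^sup>2 - (w + x) * k + (w * x - y\<^sup>2)" for w x y :: real
      by (simp add: power2_eq_square algebra_simps)
    show ?thesis
      unfolding sym * tr dt by (simp add: power2_eq_square algebra_simps)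
  qed
  then show ?thesis
    unfolding eigenvalue_2x2_iff[OF A] by simp
qed

text \<open>The Gram matrix has trace (p + q)^2 - 2 p q = p^2 + q^2 and determinant (p q)^2, so its
  eigenvalues are p^2 and q^2; nonnegativity lets \<open>sqrt\<close> return p and q.\<close>

lemma singular_values_sym_2x2:
  assumes "p \<ge> 0" "q \<ge> 0"
  shows "singular_values A = {p, q}"
proof -
  let ?G = "transpose_mat A * A"
  have G: "?G \<in> carrier_mat 2 2"
    using A by auto
  have ent: "?G $$ (0,0) = (A $$ (0,0))\<^sup>2 + (A $$ (1,0))\<^sup>2"
    "?G $$ (0,1) = A $$ (0,0) * A $$ (1,0) + A $$ (1,0) * A $$ (1,1)"
    "?G $$ (1,0) = A $$ (0,0) * A $$ (1,0) + A $$ (1,0) * A $$ (1,1)"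
    "?G $$ (1,1) = (A $$ (1,0))\<^sup>2 + (A $$ (1,1))\<^sup>2"
    using A sym by (auto simp: scalar_prod_def numeral_2_eq_2 power2_eq_square)
  have "(?G $$ (0,0) - k) * (?G $$ (1,1) - k) - ?G $$ (0,1) * ?G $$ (1,0) = (k - p\<^sup>2) * (k - q\<^sup>2)" for k
  proof -
    have *: "(w\<^sup>2 + y\<^sup>2 - k) * (y\<^sup>2 + x\<^sup>2 - k) - (w * y + y * x) * (w * y + y * x)
        = k\<^sup>2 - ((w + x)\<^sup>2 - 2 * (w * x - y\<^sup>2)) * k + (w * x - y\<^sup>2)\<^sup>2" for w x y :: real
      by (simp add: power2_eq_square algebra_simps)
    show ?thesis
      unfolding ent * tr dt by (simp add: power2_eq_square algebra_simps)
  qed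
  then have "eigenvalue ?G k \<longleftrightarrow> k = p\<^sup>2 \<or> k = q\<^sup>2" for k
    unfolding eigenvalue_2x2_iff[OF G] by simp
  moreover have "sqrt (p\<^sup>2) = p" "sqrt (q\<^sup>2) = q"
    using assms by auto
  ultimately show ?thesis
    unfolding singular_values_def by (auto intro: exI[of _ "p\<^sup>2"] exI[of _ "q\<^sup>2"])
qed

end

text \<open>With a positive minimum, the quotient of extremes dominates the quotient of any two
  members of the spectrum.\<close>

lemma condition_number_ge:
  assumes "finite (singular_values A)" "\<And>\<sigma>. \<sigma> \<in> singular_values A \<Longrightarrow> \<sigma> > 0"
    and "u \<in> singular_values A" "v \<in> singular_values A"
  shows "u / v \<le> condition_number A"
proof -
  have "Min (singular_values A) \<in> singular_values A"
    using assms by (intro Min_in) auto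
  then have "Min (singular_values A) > 0" "Min (singular_values A) \<le> v" "u \<le> Max (singular_values A)" "0 < u"
    using assms by auto
  then show ?thesis
    unfolding condition_number_def by (intro frac_le) auto
qed

lemma condition_number_eq:
  assumes "finite (singular_values A)" "singular_values A \<subseteq> {m..M}"
    and "m \<in> singular_values A" "M \<in> singular_values A"
  shows "condition_number A = M / m"
proof -
  have "Max (singular_values A) = M" "Min (singular_values A) = m"
    using assms by (auto intro!: Max_eqI Min_eqI)
  then show ?thesis
    by (simp add: condition_number_def)
qed

subsection \<open>The spike model\<close>

text \<open>A spike above \<open>ell1_plus\<close> is therefore outside the bulk, so the explicit
  formula for the cosine applies to it.\<close>

lemma ell_plus_less_ell1_plus:
  assumes "\<gamma> > 0"
  shows "ell_plus \<gamma> < ell1_plus \<gamma>"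
proof -
  have "(2 * sqrt \<gamma>)\<^sup>2 < \<gamma>\<^sup>2 + 8 * \<gamma>"
    using assms by (simp add: power_mult_distrib add_pos_pos)
  then have "2 * sqrt \<gamma> < sqrt (\<gamma>\<^sup>2 + 8 * \<gamma>)"
    by (rule real_less_rsqrt)
  then show ?thesis
    using assms by (simp add: ell_plus_def ell1_plus_def field_simps)
qed

text \<open>With x = l - 1, the number \<open>ell1_plus \<gamma> - 1\<close> is the positive root of
  x^2 - \<gamma> x - 2 \<gamma>.\<close>

lemma ell1_plus_less_iff:
  assumes "\<gamma> > 0" "l > 1"
  shows "ell1_plus \<gamma> < l \<longleftrightarrow> \<gamma> * (l - 1) + 2 * \<gamma> < (l - 1)\<^sup>2"
proof -
  define x D where "x = l - 1" and "D = sqrt (\<gamma>\<^sup>2 + 8 * \<gamma>)"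
  have D2: "D\<^sup>2 = \<gamma>\<^sup>2 + 8 * \<gamma>"
    using assms by (simp add: D_def)
  \<comment> \<open>The other root (\<gamma> - D) / 2 is negative, so for x > 0 the sign of the
    quadratic is that of the remaining factor.\<close>
  have "\<gamma> < D"
    unfolding D_def using assms by (intro real_less_rsqrt) simp
  then have pos: "x - (\<gamma> - D) / 2 > 0"
    using assms by (simp add: x_def)
  have "(x - (\<gamma> + D) / 2) * (x - (\<gamma> - D) / 2) = x\<^sup>2 - \<gamma> * x + (\<gamma>\<^sup>2 - D\<^sup>2) / 4"
    by (simp add: power2_eq_square field_simps)
  also have "\<dots> = x\<^sup>2 - (\<gamma> * x + 2 * \<gamma>)"
    unfolding D2 by simp
  finally have "\<gamma> * x + 2 * \<gamma> < x\<^sup>2 \<longleftrightarrow> x - (\<gamma> + D) / 2 > 0"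
    using pos by (metis diff_gt_0_iff_gt zero_less_mult_iff order_less_asym)
  then show ?thesis
    by (simp add: ell1_plus_def x_def D_def algebra_simps)
qed

lemma spike_gt:
  assumes "\<gamma> > 0" "l > ell_plus \<gamma>"
  shows "l > 1" "\<gamma> < (l - 1)\<^sup>2"
proof -
  have "sqrt \<gamma> < l - 1"
    using assms by (simp add: ell_plus_def)
  then have "(sqrt \<gamma>)\<^sup>2 < (l - 1)\<^sup>2"
    using assms by (intro power_strict_mono) auto
  then show "\<gamma> < (l - 1)\<^sup>2"
    using assms by simp
  show "l > 1"
    using \<open>sqrt \<gamma> < l - 1\<close> real_sqrt_gt_zero[OF assms(1)] by linarith
qed

text \<open>With m = 1 + \<gamma> / (l - 1), the numbers l and m have product \<lambda> and sum
  \<lambda> + 1 - \<gamma>. Above the threshold m < l, so the positive sign of the root in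
  \<open>ell_of\<close> selects l.\<close>

lemma ell_of_lambda_of:
  assumes "\<gamma> > 0" "l > ell_plus \<gamma>"
  shows "ell_of (lambda_of l \<gamma>) \<gamma> = l"
proof -
  note l = spike_gt[OF assms]
  define m where "m = 1 + \<gamma> / (l - 1)"
  have lam: "lambda_of l \<gamma> = l * m"
    using assms by (simp add: lambda_of_def m_def)
  have sum: "l * m + 1 - \<gamma> = l + m"
    using l by (simp add: m_def field_simps)
  have "m < l"
    using l by (simp add: m_def field_simps power2_eq_square)
  moreover have "(l + m)\<^sup>2 - 4 * (l * m) = (l - m)\<^sup>2"
    by (simp add: power2_eq_square algebra_simps)
  ultimately show ?thesis
    unfolding ell_of_def lam sum by simp
qed

lemma lambda_plus_less_lambda_of:
  assumes "\<gamma> > 0" "l > ell_plus \<gamma>"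
  shows "lambda_plus \<gamma> < lambda_of l \<gamma>"
proof -
  define x g where "x = l - 1" and "g = sqrt \<gamma>"
  have g: "g > 0" "g\<^sup>2 = \<gamma>" and x: "x > 0" "x > g"
    using assms spike_gt[OF assms] by (auto simp: x_def g_def ell_plus_def)
  \<comment> \<open>The gap to the bulk edge is a square over x, which vanishes only at x = sqrt
    \<gamma>.\<close>
  have "(1 + x) * (1 + g\<^sup>2 / x) - (1 + g)\<^sup>2 = (x - g)\<^sup>2 / x"
    using x by (simp add: power2_eq_square field_simps)
  moreover have "(x - g)\<^sup>2 / x > 0"
    using x by simp
  ultimately show ?thesis
    using assms by (simp add: lambda_of_def lambda_plus_def g x_def g_def)
qed

section \<open>Eigenvalue pairs of a block\<close>

text \<open>The entries of \<open>A_mat\<close> enter only through trace \<open>\<eta> a + b\<close> and determinant \<open>\<eta> / l\<close>.\<close>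
definition eigenpair :: "real \<Rightarrow> real \<Rightarrow> real \<Rightarrow> real \<Rightarrow> real \<Rightarrow> bool" where
  "eigenpair \<gamma> l \<eta> p q \<longleftrightarrow>
     0 < p \<and> p \<le> q \<and> p + q = \<eta> * coef_a l \<gamma> + coef_b l \<gamma> \<and> p * q = \<eta> / l"

lemma A_mat_carrier: "A_mat l \<eta> \<gamma> \<in> carrier_mat 2 2"
  by (auto simp: A_mat_def Let_def mat_of_rows_list_def)

lemma A_mat_sym: "A_mat l \<eta> \<gamma> $$ (0,1) = A_mat l \<eta> \<gamma> $$ (1,0)"
  by (simp add: A_mat_def Let_def mat_of_rows_list_def)

lemma eigenpair_charpoly:
  assumes "eigenpair \<gamma> l \<eta> p q"
  shows "t\<^sup>2 - (\<eta> * coef_a l \<gamma> + coef_b l \<gamma>) * t + \<eta> / l = (t - p) * (t - q)"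
proof -
  have "(t - p) * (t - q) = t\<^sup>2 - (p + q) * t + p * q"
    by (simp add: power2_eq_square algebra_simps)
  with assms show ?thesis
    by (simp add: eigenpair_def)
qed

text \<open>Eigenvalues are located by the sign of the characteristic polynomial at a test point,
  without solving it. The test points used are 1 / l and 1.\<close>

lemma eigenpair_between:
  assumes "eigenpair \<gamma> l \<eta> p q" and "t\<^sup>2 - (\<eta> * coef_a l \<gamma> + coef_b l \<gamma>) * t + \<eta> / l \<le> 0"
  shows "p \<le> t \<and> t \<le> q"
  using assms unfolding eigenpair_charpoly[OF assms(1)] by (auto simp: mult_le_0_iff eigenpair_def)

lemma eigenpair_between_strict:
  assumes "eigenpair \<gamma> l \<eta> p q" and "t\<^sup>2 - (\<eta> * coef_a l \<gamma> + coef_b l \<gamma>) * t + \<eta> / l < 0"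
  shows "p < t \<and> t < q"
  using assms unfolding eigenpair_charpoly[OF assms(1)] by (auto simp: mult_less_0_iff eigenpair_def)

text \<open>For t = q / p the quantity (p + q)^2 / (p q) equals t + 2 + 1 / t, which increases for t
  \<ge> 1. Comparing condition numbers thus reduces to comparing squared trace over
  determinant.\<close>

lemma ratio_mono:
  fixes p q p' q' :: real
  assumes "0 < p" "p \<le> q" "0 < p'" "p' \<le> q'"
    and "(p' + q')\<^sup>2 / (p' * q') \<le> (p + q)\<^sup>2 / (p * q)"
  shows "q' / p' \<le> q / p"
proof (rule ccontr)
  assume "\<not> ?thesis"
  then have less: "q * p' < p * q'"
    using assms by (simp add: field_simps)
  have "(p' + q')\<^sup>2 * (p * q) \<le> (p + q)\<^sup>2 * (p' * q')"
    using assms by (simp add: field_simps)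
  then have "0 \<le> (q * p' - p * q') * (q * q' - p * p')"
    by (simp add: power2_eq_square algebra_simps)
  with less have "q * q' \<le> p * p'"
    by (simp add: zero_le_mult_iff)
  moreover have "p * p' \<le> q * p'" "p * q' \<le> q * q'"
    using assms by auto
  ultimately show False
    using less by linarith
qed

context
  fixes \<gamma> :: real
  assumes \<gamma>: "\<gamma> > 0"
begin

section \<open>The map from empirical eigenvalues back to spikes\<close>

lemma lambda_plus_facts:
  assumes "lam > lambda_plus \<gamma>"
  shows "2 * sqrt \<gamma> < lam - 1 - \<gamma>" "(lam + 1 - \<gamma>)\<^sup>2 - 4 * lam = (lam - 1 - \<gamma>)\<^sup>2 - 4 * \<gamma>"
    "4 * \<gamma> < (lam - 1 - \<gamma>)\<^sup>2"
proof -
  show gt: "2 * sqrt \<gamma> < lam - 1 - \<gamma>"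
    using assms \<gamma> by (simp add: lambda_plus_def power2_sum)
  \<comment> \<open>This form of the discriminant makes both its positivity and its monotonicity
    above the bulk edge visible.\<close>
  show "(lam + 1 - \<gamma>)\<^sup>2 - 4 * lam = (lam - 1 - \<gamma>)\<^sup>2 - 4 * \<gamma>"
    by (simp add: power2_eq_square algebra_simps)
  have "(2 * sqrt \<gamma>)\<^sup>2 < (lam - 1 - \<gamma>)\<^sup>2"
    using gt \<gamma> by (intro power_strict_mono) auto
  then show "4 * \<gamma> < (lam - 1 - \<gamma>)\<^sup>2"
    using \<gamma> by (simp add: power_mult_distrib)
qed

lemma ell_plus_less_ell_of:
  assumes "lam > lambda_plus \<gamma>"
  shows "ell_plus \<gamma> < ell_of lam \<gamma>"
proof -
  note f = lambda_plus_facts[OF assms]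
  have "sqrt ((lam + 1 - \<gamma>)\<^sup>2 - 4 * lam) > 0"
    using f by simp
  with f(1) have "2 + 2 * sqrt \<gamma> < lam + 1 - \<gamma> + sqrt ((lam + 1 - \<gamma>)\<^sup>2 - 4 * lam)"
    by linarith
  then show ?thesis
    by (simp add: ell_of_def ell_plus_def)
qed

lemma ell_of_strict_mono:
  assumes "lam > lambda_plus \<gamma>" "lam < lam'"
  shows "ell_of lam \<gamma> < ell_of lam' \<gamma>"
proof -
  have *: "lam' > lambda_plus \<gamma>"
    using assms by simp
  note f = lambda_plus_facts[OF assms(1)] and f' = lambda_plus_facts[OF *]
  have "(lam - 1 - \<gamma>)\<^sup>2 \<le> (lam' - 1 - \<gamma>)\<^sup>2"
    using assms f(1) real_sqrt_gt_zero[OF \<gamma>] by (intro power_mono) linarith+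
  then have "sqrt ((lam + 1 - \<gamma>)\<^sup>2 - 4 * lam) \<le> sqrt ((lam' + 1 - \<gamma>)\<^sup>2 - 4 * lam')"
    unfolding f(2) f'(2) by simp
  with assms(2) have "lam + 1 - \<gamma> + sqrt ((lam + 1 - \<gamma>)\<^sup>2 - 4 * lam)
      < lam' + 1 - \<gamma> + sqrt ((lam' + 1 - \<gamma>)\<^sup>2 - 4 * lam')"
    by linarith
  then show ?thesis
    by (simp add: ell_of_def)
qed

section \<open>Cosines and the coefficients a and b of a spike\<close>

lemma cos_of_power2:
  assumes "l \<ge> 1"
  shows "0 \<le> (cos_of l \<gamma>)\<^sup>2" "(cos_of l \<gamma>)\<^sup>2 \<le> 1"
    "l > ell_plus \<gamma> \<Longrightarrow> (cos_of l \<gamma>)\<^sup>2 = (1 - \<gamma> / (l - 1)\<^sup>2) / (1 + \<gamma> / (l - 1))"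
proof -
  show eq: "(cos_of l \<gamma>)\<^sup>2 = (1 - \<gamma> / (l - 1)\<^sup>2) / (1 + \<gamma> / (l - 1))" if "l > ell_plus \<gamma>"
  proof -
    note l = spike_gt[OF \<gamma> that]
    have "(1 - \<gamma> / (l - 1)\<^sup>2) / (1 + \<gamma> / (l - 1)) \<ge> 0"
      using l \<gamma> by (intro divide_nonneg_pos add_pos_pos) auto
    then show ?thesis
      using that by (simp add: cos_of_def)
  qed
  show "(cos_of l \<gamma>)\<^sup>2 \<le> 1"
  proof (cases "l > ell_plus \<gamma>")
    case True
    note l = spike_gt[OF \<gamma> True]
    have "\<gamma> / (l - 1)\<^sup>2 \<ge> 0" "\<gamma> / (l - 1) > 0"
      using l \<gamma> by auto
    then have "1 - \<gamma> / (l - 1)\<^sup>2 \<le> 1 + \<gamma> / (l - 1)" "1 + \<gamma> / (l - 1) > 0"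
      by linarith+
    then show ?thesis
      unfolding eq[OF True] by (simp add: divide_le_eq)
  qed (simp add: cos_of_def)
qed simp

lemma sin_of_power2: "l \<ge> 1 \<Longrightarrow> (sin_of l \<gamma>)\<^sup>2 = 1 - (cos_of l \<gamma>)\<^sup>2"
  using cos_of_power2(2)[of l] by (simp add: sin_of_def)

lemma coef_eqs:
  assumes "l \<ge> 1"
  shows "coef_a l \<gamma> = (cos_of l \<gamma>)\<^sup>2 / l + (1 - (cos_of l \<gamma>)\<^sup>2)"
    "coef_b l \<gamma> = (1 - (cos_of l \<gamma>)\<^sup>2) / l + (cos_of l \<gamma>)\<^sup>2"
  using sin_of_power2[OF assms] by (auto simp: coef_a_def coef_b_def)

text \<open>The angle cancels because the squares of cosine and sine add up to 1; this is the trace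
  of a block with \<eta> = 1.\<close>

lemma coef_add: "l \<ge> 1 \<Longrightarrow> coef_a l \<gamma> + coef_b l \<gamma> = 1 + 1 / l"
  by (simp add: coef_eqs field_simps)

text \<open>Both coefficients are convex combinations of 1 / l and 1, with the two weights
  interchanged.\<close>

lemma coef_pos:
  assumes "l \<ge> 1"
  shows "coef_a l \<gamma> > 0" "coef_b l \<gamma> > 0"
proof -
  define t where "t = (cos_of l \<gamma>)\<^sup>2"
  have t: "0 \<le> t" "t \<le> 1"
    using cos_of_power2[OF assms] by (auto simp: t_def)
  have "t / l + (1 - t) > 0" "(1 - t) / l + t > 0"
    using t assms by (cases "t = 1"; cases "t = 0"; simp add: add_nonneg_pos add_pos_nonneg)+
  then show "coef_a l \<gamma> > 0" "coef_b l \<gamma> > 0"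
    using assms by (auto simp: coef_eqs t_def)
qed

lemma coef_bulk:
  assumes "l \<le> ell_plus \<gamma>" "l \<ge> 1"
  shows "coef_a l \<gamma> = 1" "coef_b l \<gamma> = 1 / l"
  using assms by (auto simp: coef_eqs cos_of_def)

text \<open>In x = l - 1, the quantities b and a l are fractions with the common denominator x +
  \<gamma>. This is why a is multiplied by l here and in later bounds.\<close>

lemma coef_spike:
  assumes "l > ell_plus \<gamma>"
  shows "coef_b l \<gamma> = (l - 1) / (l - 1 + \<gamma>)"
    "coef_a l \<gamma> * l = ((1 + \<gamma>) * (l - 1) + 2 * \<gamma>) / (l - 1 + \<gamma>)"
proof -
  define x where "x = l - 1"
  have x: "x > 0" "l = 1 + x" "x + \<gamma> > 0" "x * (x + \<gamma>) > 0"
    using spike_gt[OF \<gamma> assms] \<gamma> by (auto simp: x_def)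
  have c: "(cos_of l \<gamma>)\<^sup>2 = (x\<^sup>2 - \<gamma>) / (x * (x + \<gamma>))"
  proof -
    have "(1 - \<gamma> / x\<^sup>2) = (x\<^sup>2 - \<gamma>) / x\<^sup>2" "1 + \<gamma> / x = (x + \<gamma>) / x"
      using x by (auto simp: field_simps)
    then show ?thesis
      using cos_of_power2(3)[of l] assms x by (simp add: x_def[symmetric] power2_eq_square)
  qed
  have s: "1 - (x\<^sup>2 - \<gamma>) / (x * (x + \<gamma>)) = \<gamma> * l / (x * (x + \<gamma>))"
    using x by (simp add: field_simps power2_eq_square)
  have l: "l \<ge> 1" "l > 0"
    using x by auto
  have "coef_b l \<gamma> = \<gamma> / (x * (x + \<gamma>)) + (x\<^sup>2 - \<gamma>) / (x * (x + \<gamma>))"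
    unfolding coef_eqs[OF l(1)] c s using l by simp
  also have "\<dots> = x / (x + \<gamma>)"
    using x by (simp add: add_divide_distrib[symmetric] power2_eq_square)
  finally show "coef_b l \<gamma> = (l - 1) / (l - 1 + \<gamma>)"
    by (simp add: x_def)
  have "coef_a l \<gamma> * l = (x\<^sup>2 - \<gamma>) / (x * (x + \<gamma>)) + \<gamma> * l * l / (x * (x + \<gamma>))"
    unfolding coef_eqs[OF l(1)] c s distrib_right using l by simp
  \<comment> \<open>The constant terms -\<gamma> and \<gamma> cancel, so a factor x splits off and
    cancels against the denominator.\<close>
  also have "\<dots> = (x * ((1 + \<gamma>) * x + 2 * \<gamma>)) / (x * (x + \<gamma>))"
    unfolding x(2) add_divide_distrib[symmetric] by (simp add: power2_eq_square algebra_simps)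
  also have "\<dots> = ((1 + \<gamma>) * x + 2 * \<gamma>) / (x + \<gamma>)"
    using x by simp
  finally show "coef_a l \<gamma> * l = ((1 + \<gamma>) * (l - 1) + 2 * \<gamma>) / (l - 1 + \<gamma>)"
    by (simp add: x_def)
qed

text \<open>After multiplication by l, the comparison becomes x^2 \<le> \<gamma> x + 2 \<gamma>. So
  \<open>ell1_plus\<close> is the point where the unconstrained optimum b / a passes 1. In the bulk
  both sides hold.\<close>

lemma coef_b_le_a_iff:
  assumes "l \<ge> 1"
  shows "coef_b l \<gamma> \<le> coef_a l \<gamma> \<longleftrightarrow> l \<le> ell1_plus \<gamma>"
proof (cases "l > ell_plus \<gamma>")
  case True
  define x where "x = l - 1"
  have x: "x > 0" "l = 1 + x" "x + \<gamma> > 0" "l \<le> ell1_plus \<gamma> \<longleftrightarrow> x\<^sup>2 \<le> \<gamma> * x + 2 * \<gamma>"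
    using spike_gt[OF \<gamma> True] ell1_plus_less_iff[OF \<gamma>, of l] \<gamma> by (auto simp: x_def not_less[symmetric])
  have "coef_b l \<gamma> \<le> coef_a l \<gamma> \<longleftrightarrow> coef_b l \<gamma> * l \<le> coef_a l \<gamma> * l"
    using x by simp
  also have "\<dots> \<longleftrightarrow> x * l \<le> (1 + \<gamma>) * x + 2 * \<gamma>"
    unfolding coef_spike[OF True] x_def[symmetric] times_divide_eq_left
    using x by (simp add: divide_le_cancel)
  also have "\<dots> \<longleftrightarrow> l \<le> ell1_plus \<gamma>"
    unfolding x(4) unfolding x(2) by (simp add: power2_eq_square algebra_simps)
  finally show ?thesis .
next
  case False
  with assms ell_plus_less_ell1_plus[OF \<gamma>] show ?thesis
    by (simp add: coef_bulk)
qed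

text \<open>The closed formula in \<open>eta1\<close> is b l / (a l) written out, that is, the
  equality case b / a of AM-GM.\<close>

lemma eta1_lambda_of:
  assumes "l \<ge> 1"
  shows "eta1 (lambda_of l \<gamma>) \<gamma> = (if l > ell1_plus \<gamma> then coef_b l \<gamma> / coef_a l \<gamma> else 1)"
proof (cases "l > ell_plus \<gamma>")
  case True
  define x where "x = l - 1"
  have x: "x > 0" "l = 1 + x" and y: "x + \<gamma> > 0" "(1 + \<gamma>) * x + 2 * \<gamma> > 0"
    using spike_gt[OF \<gamma> True] \<gamma> by (auto simp: x_def intro!: add_pos_pos)
  have "coef_b l \<gamma> / coef_a l \<gamma> = coef_b l \<gamma> * l / (coef_a l \<gamma> * l)"
    using x by simp
  also have "\<dots> = x * l / ((1 + \<gamma>) * x + 2 * \<gamma>)"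
    unfolding coef_spike[OF True] x_def[symmetric] using y by simp
  also have "\<dots> = l / (1 + \<gamma> + 2 * \<gamma> / x)"
    using x y by (simp add: divide_simps)
  finally show ?thesis
    using ell_of_lambda_of[OF \<gamma> True] lambda_plus_less_lambda_of[OF \<gamma> True]
    by (simp add: eta1_def x_def)
next
  case False
  then show ?thesis
    using ell_plus_less_ell1_plus[OF \<gamma>] by (simp add: eta1_def lambda_of_def)
qed

subsection \<open>The spectrum of a block and the single-spike bound\<close>

text \<open>With C and 1 - C for the squares of cosine and sine, the numerator of the determinant
  collapses to \<eta>, and the angle survives only in the trace.\<close>

lemma A_mat_trace_det:
  assumes "l \<ge> 1"
  shows "A_mat l \<eta> \<gamma> $$ (0,0) + A_mat l \<eta> \<gamma> $$ (1,1) = \<eta> * coef_a l \<gamma> + coef_b l \<gamma>"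
    "A_mat l \<eta> \<gamma> $$ (0,0) * A_mat l \<eta> \<gamma> $$ (1,1) - (A_mat l \<eta> \<gamma> $$ (1,0))\<^sup>2 = \<eta> / l"
proof -
  define C where "C = (cos_of l \<gamma>)\<^sup>2"
  note s = sin_of_power2[OF assms, folded C_def]
  have ent: "A_mat l \<eta> \<gamma> $$ (0,0) = (\<eta> * C + (1 - C)) / l"
    "A_mat l \<eta> \<gamma> $$ (1,1) = C + \<eta> * (1 - C)"
    "(A_mat l \<eta> \<gamma> $$ (1,0))\<^sup>2 = (\<eta> - 1)\<^sup>2 * C * (1 - C) / l"
    using assms
    by (auto simp: A_mat_def Let_def mat_of_rows_list_def s power_divide power_mult_distrib C_def[symmetric])
  show "A_mat l \<eta> \<gamma> $$ (0,0) + A_mat l \<eta> \<gamma> $$ (1,1) = \<eta> * coef_a l \<gamma> + coef_b l \<gamma>"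
    unfolding ent coef_eqs[OF assms] C_def[symmetric] by (simp add: add_divide_distrib diff_divide_distrib algebra_simps)
  have "(\<eta> * C + (1 - C)) * (C + \<eta> * (1 - C)) - (\<eta> - 1)\<^sup>2 * C * (1 - C) = \<eta>"
    by (simp add: power2_eq_square algebra_simps)
  then show "A_mat l \<eta> \<gamma> $$ (0,0) * A_mat l \<eta> \<gamma> $$ (1,1) - (A_mat l \<eta> \<gamma> $$ (1,0))\<^sup>2 = \<eta> / l"
    unfolding ent by (metis diff_divide_distrib times_divide_eq_left)
qed

text \<open>The discriminant of a symmetric matrix is a sum of two squares, so the roots are real;
  positive trace and determinant make them positive.\<close>

lemma eigenpair_exists:
  assumes "l \<ge> 1" "\<eta> > 0"
  obtains p q where "eigenpair \<gamma> l \<eta> p q"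
proof -
  define T d where "T = \<eta> * coef_a l \<gamma> + coef_b l \<gamma>" and "d = \<eta> / l"
  define D where "D = sqrt (T\<^sup>2 - 4 * d)"
  let ?A = "A_mat l \<eta> \<gamma>"
  have "(w + x)\<^sup>2 - 4 * (w * x - y\<^sup>2) = (w - x)\<^sup>2 + 4 * y\<^sup>2" for w x y :: real
    by (simp add: power2_eq_square algebra_simps)
  then have "T\<^sup>2 - 4 * d = (?A $$ (0,0) - ?A $$ (1,1))\<^sup>2 + 4 * (?A $$ (1,0))\<^sup>2"
    unfolding T_def d_def A_mat_trace_det[OF assms(1), symmetric] by blast
  then have D: "D \<ge> 0" "D\<^sup>2 = T\<^sup>2 - 4 * d"
    by (auto simp: D_def)
  have T: "T > 0" "d > 0"
    using coef_pos[OF assms(1)] assms by (auto simp: T_def d_def intro!: add_pos_pos)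
  then have "D < T"
    using D by (intro power2_less_imp_less[of D T]) auto
  moreover have "(T - D) / 2 * ((T + D) / 2) = d"
    using D(2) by (simp add: power2_eq_square field_simps)
  moreover have "(T - D) / 2 + (T + D) / 2 = T"
    by (simp add: field_simps)
  ultimately show ?thesis
    using D(1) that[of "(T - D) / 2" "(T + D) / 2"] by (simp add: eigenpair_def T_def d_def)
qed

lemma eigenpair_A_mat:
  assumes "l \<ge> 1" "eigenpair \<gamma> l \<eta> p q"
  shows "singular_values (A_mat l \<eta> \<gamma>) = {p, q}" "nu_minus (A_mat l \<eta> \<gamma>) = p"
    "condition_number (A_mat l \<eta> \<gamma>) = q / p"
proof -
  note e = assms(2)[unfolded eigenpair_def]
  have *: "A_mat l \<eta> \<gamma> $$ (0,0) + A_mat l \<eta> \<gamma> $$ (1,1) = p + q"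
    "A_mat l \<eta> \<gamma> $$ (0,0) * A_mat l \<eta> \<gamma> $$ (1,1) - (A_mat l \<eta> \<gamma> $$ (1,0))\<^sup>2 = p * q"
    using A_mat_trace_det[OF assms(1)] e by auto
  show sv: "singular_values (A_mat l \<eta> \<gamma>) = {p, q}"
    using e by (intro singular_values_sym_2x2[OF A_mat_carrier A_mat_sym *]) auto
  have "{\<nu>. eigenvalue (A_mat l \<eta> \<gamma>) \<nu>} = {p, q}"
    by (auto simp: eigenvalue_sym_2x2_iff[OF A_mat_carrier A_mat_sym *])
  then show "nu_minus (A_mat l \<eta> \<gamma>) = p"
    using e by (simp add: nu_minus_def min_def)
  show "condition_number (A_mat l \<eta> \<gamma>) = q / p"
    using e by (intro condition_number_eq) (auto simp: sv)
qed

text \<open>The hypothesis \<open>p > 2 * r\<close> keeps the identity block nonempty, which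
  contributes the extra 1.\<close>

lemma singular_values_asymp_pivot:
  assumes "p > 2 * r" "\<And>i. i \<in> {1..r} \<Longrightarrow> ell i \<ge> 1"
    and "\<And>i. i \<in> {1..r} \<Longrightarrow> eigenpair \<gamma> (ell i) (\<eta> i) (P i) (Q i)"
  shows "singular_values (asymp_pivot p r ell \<eta> \<gamma>) = insert 1 (\<Union>i\<in>{1..r}. {P i, Q i})"
proof -
  let ?As = "map (\<lambda>i. A_mat (ell i) (\<eta> i) \<gamma>) [1..<Suc r] @ [1\<^sub>m (p - 2 * r)]"
  have sq: "square_mat A" if "A \<in> set ?As" for A
    using that carrier_matD[OF A_mat_carrier] by auto
  have "singular_values (diag_block_mat ?As) = (\<Union>A\<in>set ?As. singular_values A)"
    by (rule singular_values_diag_block_mat[OF sq])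
  moreover have "set ?As = insert (1\<^sub>m (p - 2 * r)) ((\<lambda>i. A_mat (ell i) (\<eta> i) \<gamma>) ` {1..r})"
    by (simp only: set_append set_map set_upt atLeastLessThanSuc_atLeastAtMost) simp
  ultimately have "singular_values (asymp_pivot p r ell \<eta> \<gamma>) =
      singular_values (1\<^sub>m (p - 2 * r)) \<union> (\<Union>i\<in>{1..r}. singular_values (A_mat (ell i) (\<eta> i) \<gamma>))"
    unfolding asymp_pivot_def by (simp add: atLeastLessThanSuc_atLeastAtMost del: upt_Suc)
  also have "\<dots> = insert 1 (\<Union>i\<in>{1..r}. {P i, Q i})"
    using assms(1) eigenpair_A_mat(1)[OF assms(2,3)] by (simp add: singular_values_one_mat)
  finally show ?thesis .
qed

text \<open>At \<eta> = 1 the eigenvalues are 1 / l and 1, so the polynomial at either point is a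
  multiple of \<eta> - 1 whose cofactor has a known sign.\<close>

lemma charpoly_at_inverse:
  assumes "l \<ge> 1"
  shows "(1 / l)\<^sup>2 - (\<eta> * coef_a l \<gamma> + coef_b l \<gamma>) * (1 / l) + \<eta> / l
    = (\<eta> - 1) * ((cos_of l \<gamma>)\<^sup>2 / l * (1 - 1 / l))"
  using assms by (simp add: coef_eqs power2_eq_square field_simps)

lemma charpoly_at_one:
  assumes "l \<ge> 1"
  shows "1\<^sup>2 - (\<eta> * coef_a l \<gamma> + coef_b l \<gamma>) * 1 + \<eta> / l
    = (1 - \<eta>) * ((1 - (cos_of l \<gamma>)\<^sup>2) * (1 - 1 / l))"
  using assms by (simp add: coef_eqs power2_eq_square field_simps)

lemma eigenpair_le_inverse:
  assumes "l \<ge> 1" "\<eta> \<le> 1" "eigenpair \<gamma> l \<eta> p q"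
  shows "p \<le> 1 / l"
proof -
  have "(cos_of l \<gamma>)\<^sup>2 / l * (1 - 1 / l) \<ge> 0"
    using assms by simp
  then have "(1 / l)\<^sup>2 - (\<eta> * coef_a l \<gamma> + coef_b l \<gamma>) * (1 / l) + \<eta> / l \<le> 0"
    unfolding charpoly_at_inverse[OF assms(1)] using assms by (intro mult_nonpos_nonneg) auto
  then show ?thesis
    using eigenpair_between[OF assms(3)] by blast
qed

lemma eigenpair_one_between:
  assumes "l \<ge> 1" "\<eta> \<ge> 1" "eigenpair \<gamma> l \<eta> p q"
  shows "p \<le> 1 \<and> 1 \<le> q"
proof -
  have "(1 - (cos_of l \<gamma>)\<^sup>2) * (1 - 1 / l) \<ge> 0"
    using assms cos_of_power2[OF assms(1)] by simp
  then have "1\<^sup>2 - (\<eta> * coef_a l \<gamma> + coef_b l \<gamma>) * 1 + \<eta> / l \<le> 0"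
    unfolding charpoly_at_one[OF assms(1)] using assms by (intro mult_nonpos_nonneg) auto
  then show ?thesis
    by (rule eigenpair_between[OF assms(3)])
qed

lemma eigenpair_bulk_iff:
  assumes "l \<ge> 1"
  shows "eigenpair \<gamma> l 1 p q \<longleftrightarrow> p = 1 / l \<and> q = 1"
proof
  assume e: "eigenpair \<gamma> l 1 p q"
  then have s: "p + q = 1 + 1 / l" "p * q = 1 / l" "p \<le> q"
    using coef_add[OF assms] by (auto simp: eigenpair_def)
  \<comment> \<open>For \<eta> = 1 the polynomial vanishes at 1, so one eigenvalue is 1; the order
    \<open>p \<le> q\<close> and \<open>l \<ge> 1\<close> decide which.\<close>
  have "(p - 1) * (q - 1) = p * q - (p + q) + 1"
    by (simp add: algebra_simps)
  then have "p = 1 \<or> q = 1"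
    unfolding s by simp
  with s assms show "p = 1 / l \<and> q = 1"
    by auto
next
  assume "p = 1 / l \<and> q = 1"
  then show "eigenpair \<gamma> l 1 p q"
    using assms coef_add[OF assms] by (simp add: eigenpair_def)
qed

text \<open>For \<open>\<eta> < 1\<close> both eigenvalues lie below 1, and the identity block supplies the top eigenvalue.\<close>
lemma single_spike_lower_bound:
  assumes l: "l \<ge> 1" and \<eta>: "\<eta> > 0" and e: "eigenpair \<gamma> l \<eta> p q"
    and e': "eigenpair \<gamma> l (eta1 (lambda_of l \<gamma>) \<gamma>) p' q'"
  shows "\<exists>u\<in>{1, p, q}. \<exists>v\<in>{1, p, q}. q' / p' \<le> u / v"
proof -
  define a b where "a = coef_a l \<gamma>" and "b = coef_b l \<gamma>"
  have ab: "a > 0" "b > 0"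
    using coef_pos[OF l] by (auto simp: a_def b_def)
  have pq: "0 < p" "p \<le> q" and v: "p + q = \<eta> * a + b" "p * q = \<eta> / l"
    using e by (auto simp: eigenpair_def a_def b_def)
  have pq': "0 < p'" "p' \<le> q'"
    using e' by (auto simp: eigenpair_def)
  consider "l > ell1_plus \<gamma>" | "l \<le> ell1_plus \<gamma>" "\<eta> \<le> 1" | "l \<le> ell1_plus \<gamma>" "\<eta> > 1"
    by linarith
  then show ?thesis
  proof cases
    case 1
    then have v': "p' + q' = b / a * a + b" "p' * q' = b / a / l"
      using e' eta1_lambda_of[OF l] by (auto simp: eigenpair_def a_def b_def)
    \<comment> \<open>AM-GM, from the square of \<eta> a - b; the bound is attained at \<eta> = b /
      a.\<close>
    have "4 * a * b * \<eta> \<le> (\<eta> * a + b)\<^sup>2"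
      using sum_power2_ge_zero[of "\<eta> * a - b" 0] by (simp add: power2_eq_square algebra_simps)
    then have "l * (4 * a * b) \<le> l * (\<eta> * a + b)\<^sup>2 / \<eta>"
      using \<eta> l by (simp add: field_simps)
    moreover have "(p' + q')\<^sup>2 / (p' * q') = l * (4 * a * b)"
      unfolding v' using ab l by (simp add: field_simps power2_eq_square)
    moreover have "(p + q)\<^sup>2 / (p * q) = l * (\<eta> * a + b)\<^sup>2 / \<eta>"
      unfolding v using l by simp
    ultimately have "q' / p' \<le> q / p"
      by (intro ratio_mono[OF pq pq']) (simp only:)
    then show ?thesis
      by blast
  next
    case 2
    then have "p' = 1 / l" "q' = 1"
      using e' eta1_lambda_of[OF l] eigenpair_bulk_iff[OF l] by auto
    \<comment> \<open>The witnesses are u = 1, from the identity block, and v = p.\<close>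
    moreover have "l \<le> 1 / p"
      using eigenpair_le_inverse[OF l 2(2) e] pq l by (simp add: field_simps)
    ultimately show ?thesis
      by force
  next
    case 3
    then have v': "p' = 1 / l" "q' = 1"
      using e' eta1_lambda_of[OF l] eigenpair_bulk_iff[OF l] by auto
    have "b \<le> a"
      using coef_b_le_a_iff[OF l] 3(1) by (simp add: a_def b_def)
    have "b * b \<le> a * a"
      using \<open>b \<le> a\<close> ab by (intro mult_mono) auto
    also have "\<dots> \<le> \<eta> * (a * a)"
      using 3 ab by simp
    \<comment> \<open>This product is the excess of squared trace over determinant relative to
      \<eta> = 1, up to a positive factor.\<close>
    finally have "0 \<le> (\<eta> - 1) * (\<eta> * a\<^sup>2 - b\<^sup>2)"
      using 3 by (simp add: power2_eq_square)
    also have "\<dots> = (\<eta> * a + b)\<^sup>2 - \<eta> * (a + b)\<^sup>2"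
      by (simp add: power2_eq_square algebra_simps)
    finally have "l * (a + b)\<^sup>2 \<le> l * (\<eta> * a + b)\<^sup>2 / \<eta>"
      using \<eta> l by (simp add: field_simps)
    moreover have "(p' + q')\<^sup>2 / (p' * q') = l * (a + b)\<^sup>2"
      unfolding v' using coef_add[OF l] l by (simp add: a_def b_def add.commute)
    moreover have "(p + q)\<^sup>2 / (p * q) = l * (\<eta> * a + b)\<^sup>2 / \<eta>"
      unfolding v using l by simp
    ultimately have "q' / p' \<le> q / p"
      by (intro ratio_mono[OF pq pq']) (simp only:)
    then show ?thesis
      by blast
  qed
qed

subsection \<open>Bounds on the smaller eigenvalue of the optimal top block\<close>

lemma nu1_minus_eq:
  assumes "l1 \<ge> 1" "eigenpair \<gamma> l1 (eta1 (lambda_of l1 \<gamma>) \<gamma>) \<nu> \<mu>"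
  shows "nu1_minus l1 \<gamma> = \<nu>" "ell_m_plus l1 \<gamma> = 1 / \<nu>"
  using eigenpair_A_mat(2)[OF assms] by (auto simp: nu1_minus_def ell_m_plus_def)

text \<open>The bracketed expression is the characteristic polynomial of the optimal top block at 1
  / G, cleared of denominators: its trace is 2 b = 2 x / (x + \<gamma>) and its determinant x /
  N.\<close>

lemma charpoly_rescaled:
  fixes x N G :: real
  assumes "x > 0" "N > 0" "G > 0"
    and "N * (x + \<gamma>) - 2 * x * N * G + x * (x + \<gamma>) * G\<^sup>2 < 0"
  shows "(1 / G)\<^sup>2 - 2 * (x / (x + \<gamma>)) * (1 / G) + x / N < 0"
proof -
  have "(1 / G)\<^sup>2 - 2 * (x / (x + \<gamma>)) * (1 / G) + x / N
      = (N * (x + \<gamma>) - 2 * x * N * G + x * (x + \<gamma>) * G\<^sup>2) / (G\<^sup>2 * N * (x + \<gamma>))"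
  proof -
    have "(1 / G)\<^sup>2 - 2 * (x / z) * (1 / G) + x / N
        = (N * z - 2 * x * N * G + x * z * G\<^sup>2) / (G\<^sup>2 * N * z)" if "z > 0" for z
      using assms(2,3) that by (simp add: field_simps power2_eq_square)
    then show ?thesis
      using assms(1) \<gamma> by simp
  qed
  also have "\<dots> < 0"
    using assms \<gamma> by (intro divide_neg_pos) auto
  finally show ?thesis .
qed

text \<open>Above \<open>ell1_plus\<close>, the characteristic polynomial is negative at 1 / G for G
  = 1 + \<gamma> and G = 1 + sqrt \<gamma>, so \<nu> lies below both test points. Between the two
  thresholds \<nu> is simply 1 / l.\<close>

lemma nu_bounds:
  assumes l: "l > ell_plus \<gamma>"
    and e: "eigenpair \<gamma> l (eta1 (lambda_of l \<gamma>) \<gamma>) \<nu> \<mu>"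
  shows "\<nu> * ell_plus \<gamma> < 1" and "l > ell1_plus \<gamma> \<Longrightarrow> \<nu> * (1 + \<gamma>) < 1"
proof -
  define g x where "g = sqrt \<gamma>" and "x = l - 1"
  define N where "N = (1 + \<gamma>) * x + 2 * \<gamma>"
  have g: "g > 0" "\<gamma> = g\<^sup>2"
    using \<gamma> by (auto simp: g_def)
  have l1: "l \<ge> 1"
    using spike_gt[OF \<gamma> l] by simp
  have x: "x > 0" "x > g"
    using spike_gt[OF \<gamma> l] l by (auto simp: x_def g_def ell_plus_def)
  have N: "N > 0"
    using x \<gamma> by (auto simp: N_def intro!: add_pos_pos)
  have less: "\<nu> * G < 1"
    if big: "l > ell1_plus \<gamma>" and G: "G > 0"
      and neg: "N * (x + \<gamma>) - 2 * x * N * G + x * (x + \<gamma>) * G\<^sup>2 < 0" for G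
  proof -
    define a b where "a = coef_a l \<gamma>" and "b = coef_b l \<gamma>"
    have ab: "a > 0" "b > 0"
      using coef_pos[OF l1] by (auto simp: a_def b_def)
    have b: "b = x / (x + \<gamma>)" and al: "a * l = N / (x + \<gamma>)"
      using coef_spike[OF l] by (auto simp: a_def b_def x_def N_def)
    have \<eta>: "eta1 (lambda_of l \<gamma>) \<gamma> = b / a"
      using eta1_lambda_of[OF l1] big by (simp add: a_def b_def)
    have "b / a / l = b / (a * l)"
      by simp
    also have "\<dots> = x / N"
      unfolding al b using x \<gamma> by simp
    finally have "b / a / l = x / N" .
    moreover have "b / a * a + b = 2 * b"
      using ab by simp
    ultimately have "(1 / G)\<^sup>2 - (eta1 (lambda_of l \<gamma>) \<gamma> * coef_a l \<gamma> + coef_b l \<gamma>) * (1 / G)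
        + eta1 (lambda_of l \<gamma>) \<gamma> / l < 0"
      unfolding \<eta> a_def[symmetric] b_def[symmetric]
      using charpoly_rescaled[OF x(1) N G neg] by (simp only: b)
    then have "\<nu> < 1 / G"
      using eigenpair_between_strict[OF e] by blast
    then show ?thesis
      using G by (simp add: field_simps)
  qed
  show "\<nu> * (1 + \<gamma>) < 1" if big: "l > ell1_plus \<gamma>"
  proof (rule less[OF big])
    have big': "\<gamma> * x + 2 * \<gamma> < x\<^sup>2"
      using big spike_gt[OF \<gamma> l] ell1_plus_less_iff[OF \<gamma>, of l] by (simp add: x_def)
    have "N * (x + \<gamma>) - 2 * x * N * (1 + \<gamma>) + x * (x + \<gamma>) * (1 + \<gamma>)\<^sup>2
        = \<gamma> * ((1 + \<gamma>) * (\<gamma> * x + 2 * \<gamma> - x\<^sup>2) - 2 * \<gamma> * x - 2 * \<gamma>\<^sup>2)"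
      by (simp add: N_def power2_eq_square algebra_simps)
    also have "\<dots> < 0"
    proof -
      have "(1 + \<gamma>) * (\<gamma> * x + 2 * \<gamma> - x\<^sup>2) < 0"
        using big' \<gamma> by (intro mult_pos_neg) auto
      moreover have "2 * \<gamma> * x > 0" "2 * \<gamma>\<^sup>2 > 0"
        using \<gamma> x by auto
      ultimately show ?thesis
        using \<gamma> by (intro mult_pos_neg) linarith+
    qed
    finally show "N * (x + \<gamma>) - 2 * x * N * (1 + \<gamma>) + x * (x + \<gamma>) * (1 + \<gamma>)\<^sup>2 < 0" .
  qed (use \<gamma> in simp)
  show "\<nu> * ell_plus \<gamma> < 1"
  proof (cases "l > ell1_plus \<gamma>")
    case True
    have "\<nu> * (1 + g) < 1"
    proof (rule less[OF True])
      \<comment> \<open>For this G the quadratic factors completely, and its sign is that of g - x,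
        negative above the bulk edge.\<close>
      have "N * (x + \<gamma>) - 2 * x * N * (1 + g) + x * (x + \<gamma>) * (1 + g)\<^sup>2
          = 2 * g * g\<^sup>2 * (x + 1) * (g - x)"
        by (simp add: N_def g(2) power2_eq_square algebra_simps)
      also have "\<dots> < 0"
        using g(1) x by (intro mult_pos_neg) auto
      finally show "N * (x + \<gamma>) - 2 * x * N * (1 + g) + x * (x + \<gamma>) * (1 + g)\<^sup>2 < 0" .
    qed (use g in simp)
    then show ?thesis
      by (simp add: g_def ell_plus_def)
  next
    case False
    then have "\<nu> = 1 / l"
      using e eta1_lambda_of[OF l1] eigenpair_bulk_iff[OF l1] by simp
    then show ?thesis
      using l l1 by simp
  qed
qed

text \<open>This keeps the denominator in the shrinkage formula away from 0. As a function of x, a l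
  runs monotonically from 1 + sqrt \<gamma> at the bulk edge towards 1 + \<gamma> at infinity, and
  \<nu> times either bound is below 1.\<close>

lemma nu_coef_a_less:
  assumes l1: "l1 > ell1_plus \<gamma>" and e: "eigenpair \<gamma> l1 (eta1 (lambda_of l1 \<gamma>) \<gamma>) \<nu> \<mu>"
    and l: "l \<ge> 1"
  shows "\<nu> * (coef_a l \<gamma> * l) < 1"
proof (cases "l > ell_plus \<gamma>")
  case True
  define g x where "g = sqrt \<gamma>" and "x = l - 1"
  define N where "N = (1 + \<gamma>) * x + 2 * \<gamma>"
  have g: "g > 0" "\<gamma> = g\<^sup>2"
    using \<gamma> by (auto simp: g_def)
  have x: "x > 0" "x > g"
    using spike_gt[OF \<gamma> True] True by (auto simp: x_def g_def ell_plus_def)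
  have pos: "\<nu> > 0" "x + \<gamma> > 0"
    using e \<gamma> x by (auto simp: eigenpair_def)
  have "l1 > ell_plus \<gamma>"
    using l1 ell_plus_less_ell1_plus[OF \<gamma>] by simp
  note b = nu_bounds[OF this e]
  have "\<exists>G. \<nu> * G < 1 \<and> N \<le> G * (x + \<gamma>)"
  \<comment> \<open>The larger of the two bounds is 1 + sqrt \<gamma> for \<gamma> < 1 and 1 +
    \<gamma> otherwise.\<close>
  proof (cases "\<gamma> < 1")
    case True
    then have "g < 1"
      by (simp add: g_def)
    then have "0 \<le> g * (1 - g) * (x - g)"
      using g(1) x by simp
    also have "\<dots> = (1 + g) * (x + \<gamma>) - N"
      by (simp add: N_def g(2) power2_eq_square algebra_simps)
    finally show ?thesis
      using b(1) by (intro exI[of _ "1 + g"]) (simp add: ell_plus_def g_def)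
  next
    case False
    have "0 \<le> \<gamma> * (\<gamma> - 1)"
      using False \<gamma> by simp
    also have "\<dots> = (1 + \<gamma>) * (x + \<gamma>) - N"
      by (simp add: N_def algebra_simps)
    finally show ?thesis
      using b(2)[OF l1] by (intro exI[of _ "1 + \<gamma>"]) simp
  qed
  then obtain G where G: "\<nu> * G < 1" "N \<le> G * (x + \<gamma>)"
    by blast
  then have "coef_a l \<gamma> * l \<le> G"
    using coef_spike(2)[OF True] pos by (simp add: N_def x_def pos_divide_le_eq)
  then have "\<nu> * (coef_a l \<gamma> * l) \<le> \<nu> * G"
    using pos by simp
  with G show ?thesis
    by simp
next
  case False
  have "\<nu> * l \<le> \<nu> * ell_plus \<gamma>"
    using False e by (simp add: eigenpair_def)
  also have "\<dots> < 1"
    using nu_bounds(1)[OF _ e] l1 ell_plus_less_ell1_plus[OF \<gamma>] by simp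
  finally show ?thesis
    using False l by (simp add: coef_bulk)
qed

section \<open>The shrinker as a solution of the characteristic equation\<close>

lemma eta_m_lambda_of:
  assumes l1: "l1 > ell1_plus \<gamma>" and e: "eigenpair \<gamma> l1 (eta1 (lambda_of l1 \<gamma>) \<gamma>) \<nu> \<mu>"
    and l: "l \<ge> 1"
  shows "eta_m (lambda_of l \<gamma>) (lambda_of l1 \<gamma>) \<gamma> =
    (if l > 1 / \<nu> then (\<nu> - coef_b l \<gamma>) / (coef_a l \<gamma> - 1 / (l * \<nu>)) else 1)"
proof -
  have l1': "l1 > ell_plus \<gamma>"
    using l1 ell_plus_less_ell1_plus[OF \<gamma>] by simp
  have "l1 \<ge> 1"
    using spike_gt[OF \<gamma> l1'] by simp
  note n = nu1_minus_eq[OF this e] and lam1 = ell_of_lambda_of[OF \<gamma> l1'] lambda_plus_less_lambda_of[OF \<gamma> l1']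
  \<comment> \<open>Hence l > 1 / \<nu> already forces the guard
    \<open>lam > lambda_plus \<gamma>\<close> in \<open>eta_m\<close>.\<close>
  have "ell_plus \<gamma> < 1 / \<nu>"
    using nu_bounds(1)[OF l1' e] e by (simp add: eigenpair_def field_simps)
  show ?thesis
  proof (cases "l > ell_plus \<gamma>")
    case True
    show ?thesis
      using ell_of_lambda_of[OF \<gamma> True] lambda_plus_less_lambda_of[OF \<gamma> True] lam1 l1
      by (simp add: eta_m_def Let_def n)
  next
    case False
    with \<open>ell_plus \<gamma> < 1 / \<nu>\<close> show ?thesis
      by (simp add: eta_m_def lambda_of_def)
  qed
qed

lemma eta_m_trivial:
  assumes "l1 \<ge> 1" "l1 \<le> ell1_plus \<gamma>"
  shows "eta_m lam (lambda_of l1 \<gamma>) \<gamma> = 1"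
  using assms ell_of_lambda_of[OF \<gamma>, of l1]
  by (cases "l1 > ell_plus \<gamma>") (auto simp: eta_m_def Let_def lambda_of_def)

text \<open>Solving \<open>det (A_mat l \<eta> \<gamma> - \<nu> I) = 0\<close> for \<open>\<eta>\<close> leaves the second eigenvalue
  \<open>\<eta> / (l \<nu>) = (b - \<nu>) / (1 - a l \<nu>)\<close>, a Moebius function of \<open>l\<close>.\<close>
lemma eigenpair_solved_eta:
  assumes "l > 0" "0 < \<nu>" "\<nu> * (coef_a l \<gamma> * l) < 1"
    and w: "w = (coef_b l \<gamma> - \<nu>) / (1 - \<nu> * (coef_a l \<gamma> * l))" and "\<nu> \<le> w"
  shows "eigenpair \<gamma> l ((\<nu> - coef_b l \<gamma>) / (coef_a l \<gamma> - 1 / (l * \<nu>))) \<nu> w"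
    "(\<nu> - coef_b l \<gamma>) / (coef_a l \<gamma> - 1 / (l * \<nu>)) > 0"
proof -
  define a b where "a = coef_a l \<gamma>" and "b = coef_b l \<gamma>"
  let ?d = "1 - \<nu> * (a * l)"
  have d: "?d > 0" and w: "w = (b - \<nu>) / ?d"
    using assms by (auto simp: a_def b_def)
  have ad: "a - 1 / (l * \<nu>) = - (?d / (l * \<nu>))"
    using assms by (simp add: field_simps)
  \<comment> \<open>The determinant \<eta> / l has to be \<nu> w.\<close>
  have \<eta>: "(\<nu> - b) / (a - 1 / (l * \<nu>)) = w * (l * \<nu>)"
  proof -
    have nb: "\<nu> - b = - (b - \<nu>)"
      by simp
    show ?thesis
      unfolding ad nb w by (simp del: minus_diff_eq)
  qed
  have "w * ?d = b - \<nu>"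
    using d by (simp add: w)
  then have "\<nu> + w = w * (l * \<nu>) * a + b"
    by (simp add: algebra_simps)
  then show "eigenpair \<gamma> l ((\<nu> - coef_b l \<gamma>) / (coef_a l \<gamma> - 1 / (l * \<nu>))) \<nu> w"
    unfolding a_def[symmetric] b_def[symmetric] \<eta> eigenpair_def using assms by simp
  show "(\<nu> - coef_b l \<gamma>) / (coef_a l \<gamma> - 1 / (l * \<nu>)) > 0"
    unfolding a_def[symmetric] b_def[symmetric] \<eta> using assms(1,2,5) by simp
qed

subsection \<open>Optimality of the multi-spike shrinker\<close>

lemma eta1_gt_one:
  assumes "l \<ge> 1" "l > ell1_plus \<gamma>"
  shows "eta1 (lambda_of l \<gamma>) \<gamma> > 1"
proof -
  have "coef_a l \<gamma> < coef_b l \<gamma>"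
    using assms coef_b_le_a_iff[of l] by (simp add: not_le[symmetric])
  then show ?thesis
    using eta1_lambda_of[OF assms(1)] coef_pos(1)[OF assms(1)] assms(2) by simp
qed

lemma eta1_ge_one:
  assumes "l \<ge> 1"
  shows "eta1 (lambda_of l \<gamma>) \<gamma> \<ge> 1"
  using eta1_gt_one[OF assms] eta1_lambda_of[OF assms] by fastforce

lemma eigenpair_eta1_exists:
  assumes "l \<ge> 1"
  obtains \<nu> \<mu> where "eigenpair \<gamma> l (eta1 (lambda_of l \<gamma>) \<gamma>) \<nu> \<mu>"
proof -
  have "eta1 (lambda_of l \<gamma>) \<gamma> > 0"
    using eta1_ge_one[OF assms] by simp
  then show thesis
    using eigenpair_exists[OF assms] that by blast
qed

text \<open>Since \<eta> > 1 and the cosine is nonzero, the characteristic polynomial is positive at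
  1 / l1. As 1 / l1 < 1 \<le> \<mu>, this point lies below \<nu>, so the top spike falls in the
  shrinking branch.\<close>

lemma top_spike_gt_threshold:
  assumes l1: "l1 > ell1_plus \<gamma>" and e: "eigenpair \<gamma> l1 (eta1 (lambda_of l1 \<gamma>) \<gamma>) \<nu> \<mu>"
  shows "1 / \<nu> < l1"
proof -
  have l1': "l1 > ell_plus \<gamma>"
    using l1 ell_plus_less_ell1_plus[OF \<gamma>] by simp
  note l = spike_gt[OF \<gamma> l1']
  have ge: "l1 \<ge> 1"
    using l by simp
  have "(cos_of l1 \<gamma>)\<^sup>2 > 0"
    using l l1' \<gamma> cos_of_power2(3)[OF ge]
    by (auto intro!: divide_pos_pos add_pos_pos)
  then have "(cos_of l1 \<gamma>)\<^sup>2 / l1 * (1 - 1 / l1) > 0"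
    using l by simp
  moreover have "eta1 (lambda_of l1 \<gamma>) \<gamma> > 1"
    by (rule eta1_gt_one[OF ge l1])
  ultimately have "(1 / l1 - \<nu>) * (1 / l1 - \<mu>) > 0"
    unfolding eigenpair_charpoly[OF e, symmetric] charpoly_at_inverse[OF ge] by (metis diff_gt_0_iff_gt mult_pos_pos)
  moreover have "1 / l1 < \<mu>"
    using eigenpair_one_between[OF ge eta1_ge_one[OF ge] e] l
    by (auto intro: less_le_trans[of _ 1])
  ultimately have "1 / l1 < \<nu>"
    by (simp add: zero_less_mult_iff)
  then show ?thesis
    using l e by (simp add: eigenpair_def field_simps)
qed

text \<open>At \<eta> = b / a the number \<nu> is an eigenvalue already, and the equation for \<eta>
  is linear with nonzero coefficient, so its solution is the single-spike value.\<close>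

lemma eta_m_top:
  assumes ge: "l1 \<ge> 1" and e: "eigenpair \<gamma> l1 (eta1 (lambda_of l1 \<gamma>) \<gamma>) \<nu> \<mu>"
  shows "eta_m (lambda_of l1 \<gamma>) (lambda_of l1 \<gamma>) \<gamma> = eta1 (lambda_of l1 \<gamma>) \<gamma>"
proof (cases "l1 > ell1_plus \<gamma>")
  case True
  define a b \<eta> where "a = coef_a l1 \<gamma>" and "b = coef_b l1 \<gamma>" and "\<eta> = eta1 (lambda_of l1 \<gamma>) \<gamma>"
  have \<eta>: "\<eta> * a = b"
    using True eta1_lambda_of[OF ge] coef_pos[OF ge] by (simp add: a_def b_def \<eta>_def)
  have \<nu>: "\<nu> > 0" "\<nu> + \<mu> = 2 * b" "\<nu> * \<mu> = \<eta> / l1"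
    using e \<eta> by (auto simp: eigenpair_def a_def b_def \<eta>_def)
  have "\<eta> / (l1 * \<nu>) = \<mu>"
    using \<nu> ge by (simp add: field_simps)
  then have "\<eta> * (a - 1 / (l1 * \<nu>)) = \<nu> - b"
    using \<eta> \<nu>(2) by (simp add: right_diff_distrib)
  moreover have "a - 1 / (l1 * \<nu>) \<noteq> 0"
    using nu_coef_a_less[OF True e ge] \<nu> ge by (simp add: a_def[symmetric] field_simps)
  ultimately have "(\<nu> - b) / (a - 1 / (l1 * \<nu>)) = \<eta>"
    by (metis nonzero_mult_div_cancel_right)
  then show ?thesis
    using eta_m_lambda_of[OF True e ge] top_spike_gt_threshold[OF True e]
    by (simp add: a_def b_def \<eta>_def)
next
  case False
  then show ?thesis
    using eta_m_trivial[OF ge] eta1_lambda_of[OF ge] by simp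
qed

text \<open>After cross-multiplication the difference is y - x times the determinant of the Moebius
  map. Its nonnegativity will follow from \<nu> (1 + sqrt \<gamma>) < 1.\<close>

lemma second_eigenvalue_mono:
  fixes x y \<nu> :: real
  assumes "x \<le> y" "\<nu>\<^sup>2 * \<gamma> \<le> (1 - \<nu>)\<^sup>2"
    and "x + \<gamma> - \<nu> * ((1 + \<gamma>) * x + 2 * \<gamma>) > 0" "y + \<gamma> - \<nu> * ((1 + \<gamma>) * y + 2 * \<gamma>) > 0"
  shows "(x - \<nu> * (x + \<gamma>)) / (x + \<gamma> - \<nu> * ((1 + \<gamma>) * x + 2 * \<gamma>))
    \<le> (y - \<nu> * (y + \<gamma>)) / (y + \<gamma> - \<nu> * ((1 + \<gamma>) * y + 2 * \<gamma>))"
proof -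
  have "(y - \<nu> * (y + \<gamma>)) * (x + \<gamma> - \<nu> * ((1 + \<gamma>) * x + 2 * \<gamma>))
      - (x - \<nu> * (x + \<gamma>)) * (y + \<gamma> - \<nu> * ((1 + \<gamma>) * y + 2 * \<gamma>))
      = (y - x) * (\<gamma> * ((1 - \<nu>)\<^sup>2 - \<nu>\<^sup>2 * \<gamma>))"
    by (simp add: power2_eq_square algebra_simps)
  moreover have "(y - x) * (\<gamma> * ((1 - \<nu>)\<^sup>2 - \<nu>\<^sup>2 * \<gamma>)) \<ge> 0"
    using assms \<gamma> by simp
  moreover have "A / B \<le> C / E" if "C * B - A * E \<ge> 0" "B > 0" "E > 0" for A B C E :: real
    using that by (simp add: field_simps)
  ultimately show ?thesis
    using assms(3,4) by simp
qed

text \<open>An untouched block has eigenvalues 1 / l and 1, harmless as long as \<nu> \<le> 1 / l.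
  Otherwise \<nu> becomes an eigenvalue and the other one satisfies 1 \<le> \<open>w l\<close> \<le>
  \<open>w l1\<close> = \<mu>.\<close>

lemma eta_m_eigenpair:
  assumes l1: "l1 \<ge> 1" and e: "eigenpair \<gamma> l1 (eta1 (lambda_of l1 \<gamma>) \<gamma>) \<nu> \<mu>"
    and l: "1 \<le> l" "l \<le> l1"
  obtains p q where "eigenpair \<gamma> l (eta_m (lambda_of l \<gamma>) (lambda_of l1 \<gamma>) \<gamma>) p q"
    "eta_m (lambda_of l \<gamma>) (lambda_of l1 \<gamma>) \<gamma> > 0" "\<nu> \<le> p" "q \<le> \<mu>"
proof -
  have one: "\<nu> \<le> 1" "1 \<le> \<mu>"
    using eigenpair_one_between[OF l1 eta1_ge_one[OF l1] e] by auto
  have \<nu>: "\<nu> > 0"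
    using e by (simp add: eigenpair_def)
  note witness = that
  have bulk: thesis if "eta_m (lambda_of l \<gamma>) (lambda_of l1 \<gamma>) \<gamma> = 1" "\<nu> \<le> 1 / l"
    using that \<open>1 \<le> \<mu>\<close> eigenpair_bulk_iff[OF l(1)] by (intro witness[of "1 / l" 1]) auto
  consider "l1 \<le> ell1_plus \<gamma>" | "l1 > ell1_plus \<gamma>" "l \<le> 1 / \<nu>" | "l1 > ell1_plus \<gamma>" "l > 1 / \<nu>"
    by linarith
  then show thesis
  proof cases
    case 1
    then have "\<nu> = 1 / l1"
      using e eta1_lambda_of[OF l1] eigenpair_bulk_iff[OF l1] by simp
    then have "\<nu> \<le> 1 / l"
      using l by (simp add: frac_le)
    then show thesis
      by (rule bulk[OF eta_m_trivial[OF l1 1]])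
  next
    case 2
    show thesis
    proof (rule bulk)
      show "eta_m (lambda_of l \<gamma>) (lambda_of l1 \<gamma>) \<gamma> = 1"
        using eta_m_lambda_of[OF 2(1) e l(1)] 2(2) by simp
      show "\<nu> \<le> 1 / l"
        using 2(2) \<nu> l by (simp add: field_simps)
    qed
  next
    case 3
    have l1': "l1 > ell_plus \<gamma>"
      using 3 ell_plus_less_ell1_plus[OF \<gamma>] by simp
    have ep: "\<nu> * (1 + sqrt \<gamma>) < 1"
      using nu_bounds(1)[OF l1' e] by (simp add: ell_plus_def)
    then have "ell_plus \<gamma> < 1 / \<nu>"
      using \<nu> by (simp add: ell_plus_def field_simps)
    then have l': "l > ell_plus \<gamma>"
      using 3 by simp
    define w where "w k = (coef_b k \<gamma> - \<nu>) / (1 - \<nu> * (coef_a k \<gamma> * k))" for k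
    define D where "D x = x + \<gamma> - \<nu> * ((1 + \<gamma>) * x + 2 * \<gamma>)" for x
    have Dw: "D (k - 1) > 0" "w k = ((k - 1) - \<nu> * ((k - 1) + \<gamma>)) / D (k - 1)" if k: "k > ell_plus \<gamma>" for k
    proof -
      define x N where "x = k - 1" and "N = (1 + \<gamma>) * x + 2 * \<gamma>"
      have ge: "k \<ge> 1" and pos: "x + \<gamma> > 0"
        using spike_gt[OF \<gamma> k] \<gamma> by (auto simp: x_def)
      have ab: "coef_b k \<gamma> = x / (x + \<gamma>)" "coef_a k \<gamma> * k = N / (x + \<gamma>)"
        using coef_spike[OF k] by (auto simp: x_def N_def)
      have "\<nu> * (N / (x + \<gamma>)) < 1"
        using nu_coef_a_less[OF 3(1) e ge] by (simp only: ab)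
      then have Dpos: "D x > 0"
        unfolding D_def N_def[symmetric] using pos by (simp add: pos_divide_less_eq)
      have "x / (x + \<gamma>) - \<nu> = (x - \<nu> * (x + \<gamma>)) / (x + \<gamma>)"
        "1 - \<nu> * (N / (x + \<gamma>)) = D x / (x + \<gamma>)"
        unfolding D_def N_def[symmetric] using pos by (simp_all add: diff_divide_distrib)
      then have "w k = (x - \<nu> * (x + \<gamma>)) / D x"
        unfolding w_def ab using pos by simp
      with Dpos show "D (k - 1) > 0" "w k = ((k - 1) - \<nu> * ((k - 1) + \<gamma>)) / D (k - 1)"
        by (simp_all add: x_def)
    qed
    \<comment> \<open>Numerator minus denominator of \<open>w l\<close> is \<gamma> (\<nu> l - 1),
      so passing the threshold means passing 1.\<close>
    have "1 \<le> \<nu> * l"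
      using 3(2) \<nu> by (simp add: field_simps)
    then have "\<gamma> \<le> \<gamma> * (\<nu> * l)"
      using \<gamma> by simp
    also have "\<dots> = ((l - 1) - \<nu> * ((l - 1) + \<gamma>)) - D (l - 1) + \<gamma>"
      by (simp add: D_def algebra_simps)
    finally have "1 \<le> w l"
      unfolding Dw(2)[OF l'] using Dw(1)[OF l'] by simp
    have "w l \<le> w l1"
    proof -
      have "(\<nu> * sqrt \<gamma>)\<^sup>2 \<le> (1 - \<nu>)\<^sup>2"
        using ep \<nu> \<gamma> by (intro power_mono) (auto simp: algebra_simps)
      then have "\<nu>\<^sup>2 * \<gamma> \<le> (1 - \<nu>)\<^sup>2"
        using \<gamma> by (simp add: power_mult_distrib)
      then show ?thesis
        using second_eigenvalue_mono[of "l - 1" "l1 - 1" \<nu>] Dw[OF l'] Dw[OF l1'] l(2)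
        by (simp add: D_def)
    qed
    \<comment> \<open>At the top spike the trace is 2 b and the determinant b / (a l1), which turn
      the Moebius formula back into \<mu>.\<close>
    also have "w l1 = \<mu>"
    proof -
      define a b where "a = coef_a l1 \<gamma>" and "b = coef_b l1 \<gamma>"
      have \<eta>: "eta1 (lambda_of l1 \<gamma>) \<gamma> = b / a" "a > 0"
        using 3 eta1_lambda_of[OF l1] coef_pos[OF l1] by (auto simp: a_def b_def)
      then have s: "\<nu> + \<mu> = 2 * b" "\<nu> * \<mu> = b / a / l1"
        using e by (auto simp: eigenpair_def a_def b_def)
      have "\<mu> * (1 - \<nu> * (a * l1)) = \<mu> - (\<nu> * \<mu>) * (a * l1)"
        by (simp add: algebra_simps)
      also have "\<dots> = b - \<nu>"
        unfolding s(2) using s(1) \<eta>(2) l1 by simp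
      finally show ?thesis
        using nu_coef_a_less[OF 3(1) e l1]
        by (simp add: w_def a_def b_def nonzero_divide_eq_eq)
    qed
    finally have "w l \<le> \<mu>" .
    have "eta_m (lambda_of l \<gamma>) (lambda_of l1 \<gamma>) \<gamma> = (\<nu> - coef_b l \<gamma>) / (coef_a l \<gamma> - 1 / (l * \<nu>))"
      using eta_m_lambda_of[OF 3(1) e l(1)] 3(2) by simp
    moreover have "\<nu> \<le> w l"
      using one \<open>1 \<le> w l\<close> by simp
    ultimately show thesis
      using witness[of \<nu> "w l"] \<open>w l \<le> \<mu>\<close> l
        eigenpair_solved_eta[OF _ \<nu> nu_coef_a_less[OF 3(1) e l(1)] w_def]
      by simp
  qed
qed

lemma condition_number_pivot_eta_m:
  assumes p: "p > 2 * r" and r: "r \<ge> 1"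
    and ell: "\<And>i. i \<in> {1..r} \<Longrightarrow> 1 \<le> ell i \<and> ell i \<le> ell 1"
    and e: "eigenpair \<gamma> (ell 1) (eta1 (lambda_of (ell 1) \<gamma>) \<gamma>) \<nu> \<mu>"
  defines "\<eta> \<equiv> \<lambda>i. eta_m (lambda_of (ell i) \<gamma>) (lambda_of (ell 1) \<gamma>) \<gamma>"
  shows "condition_number (asymp_pivot p r ell \<eta> \<gamma>) = \<mu> / \<nu>"
proof -
  have ge: "ell 1 \<ge> 1"
    using ell[of 1] r by simp
  have "\<exists>u v. eigenpair \<gamma> (ell i) (\<eta> i) u v \<and> \<nu> \<le> u \<and> v \<le> \<mu>" if "i \<in> {1..r}" for i
    using eta_m_eigenpair[OF ge e, of "ell i"] ell[OF that] unfolding \<eta>_def by blast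
  then obtain P Q where PQ: "\<And>i. i \<in> {1..r} \<Longrightarrow> eigenpair \<gamma> (ell i) (\<eta> i) (P i) (Q i) \<and> \<nu> \<le> P i \<and> Q i \<le> \<mu>"
    by metis
  have sv: "singular_values (asymp_pivot p r ell \<eta> \<gamma>) = insert 1 (\<Union>i\<in>{1..r}. {P i, Q i})"
    using ell PQ by (intro singular_values_asymp_pivot[OF p]) auto
  have "\<eta> 1 = eta1 (lambda_of (ell 1) \<gamma>) \<gamma>"
    using eta_m_top[OF ge e] by (simp add: \<eta>_def)
  \<comment> \<open>\<open>P\<close> and \<open>Q\<close> come from choice; the singular values of
    the top block identify them with \<nu> and \<mu>.\<close>
  then have "{P 1, Q 1} = {\<nu>, \<mu>}"
    using eigenpair_A_mat(1)[OF ge e] eigenpair_A_mat(1)[OF ge, of "\<eta> 1"] PQ[of 1] r by auto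
  then have "\<nu> \<in> singular_values (asymp_pivot p r ell \<eta> \<gamma>)" "\<mu> \<in> singular_values (asymp_pivot p r ell \<eta> \<gamma>)"
    unfolding sv using r by (metis UN_I atLeastAtMost_iff insertCI order_refl)+
  moreover have "singular_values (asymp_pivot p r ell \<eta> \<gamma>) \<subseteq> {\<nu>..\<mu>}"
  proof -
    have "\<nu> \<le> P i \<and> P i \<le> Q i \<and> Q i \<le> \<mu>" if "i \<in> {1..r}" for i
      using PQ[OF that] by (simp add: eigenpair_def)
    then show ?thesis
      unfolding sv using eigenpair_one_between[OF ge eta1_ge_one[OF ge] e] by fastforce
  qed
  ultimately show ?thesis
    by (intro condition_number_eq) (simp add: sv)
qed

text \<open>The top block and the identity block alone force the bound; all other blocks can only
  enlarge the spectrum.\<close>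

lemma condition_number_pivot_ge:
  assumes p: "p > 2 * r" and r: "r \<ge> 1"
    and ell: "\<And>i. i \<in> {1..r} \<Longrightarrow> 1 \<le> ell i"
    and \<eta>: "\<And>i. i \<in> {1..r} \<Longrightarrow> 0 < \<eta> i"
    and e: "eigenpair \<gamma> (ell 1) (eta1 (lambda_of (ell 1) \<gamma>) \<gamma>) \<nu> \<mu>"
  shows "\<mu> / \<nu> \<le> condition_number (asymp_pivot p r ell \<eta> \<gamma>)"
proof -
  have "\<exists>u v. eigenpair \<gamma> (ell i) (\<eta> i) u v" if "i \<in> {1..r}" for i
    using eigenpair_exists[OF ell[OF that] \<eta>[OF that]] by blast
  then obtain P Q where PQ: "\<And>i. i \<in> {1..r} \<Longrightarrow> eigenpair \<gamma> (ell i) (\<eta> i) (P i) (Q i)"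
    by metis
  let ?S = "singular_values (asymp_pivot p r ell \<eta> \<gamma>)"
  have sv: "?S = insert 1 (\<Union>i\<in>{1..r}. {P i, Q i})"
    using ell PQ by (intro singular_values_asymp_pivot[OF p]) auto
  have one: "1 \<in> {1..r}"
    using r by simp
  obtain u v where uv: "u \<in> {1, P 1, Q 1}" "v \<in> {1, P 1, Q 1}" "\<mu> / \<nu> \<le> u / v"
    using single_spike_lower_bound[OF ell[OF one] \<eta>[OF one] PQ[OF one] e] by blast
  have "0 < P i \<and> 0 < Q i" if "i \<in> {1..r}" for i
    using PQ[OF that] by (auto simp: eigenpair_def)
  then have "\<sigma> > 0" if "\<sigma> \<in> ?S" for \<sigma>
    using that unfolding sv by auto
  moreover have "{1, P 1, Q 1} \<subseteq> ?S"
    unfolding sv using one by blast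
  ultimately have "u / v \<le> condition_number (asymp_pivot p r ell \<eta> \<gamma>)"
    using uv by (intro condition_number_ge) (auto simp: sv)
  with uv(3) show ?thesis
    by simp
qed

section \<open>Collapse of the bulk\<close>

lemma bulk_collapse:
  assumes lam1: "lam1 > lambda_plus \<gamma>"
  defines "m \<equiv> ell_m_plus (ell_of lam1 \<gamma>) \<gamma>"
  shows "lambda_plus \<gamma> < lambda_of m \<gamma>"
    "lam < lambda_of m \<gamma> \<Longrightarrow> eta_m lam lam1 \<gamma> = 1"
proof -
  have l1: "ell_of lam1 \<gamma> > ell_plus \<gamma>"
    by (rule ell_plus_less_ell_of[OF lam1])
  then have ge: "ell_of lam1 \<gamma> \<ge> 1"
    using spike_gt(1)[OF \<gamma> l1] by simp
  obtain \<nu> \<mu> where e: "eigenpair \<gamma> (ell_of lam1 \<gamma>) (eta1 (lambda_of (ell_of lam1 \<gamma>) \<gamma>) \<gamma>) \<nu> \<mu>"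
    by (rule eigenpair_eta1_exists[OF ge])
  \<comment> \<open>The bound on \<nu> holds for every spike above \<open>ell_plus\<close>,
    including those below \<open>ell1_plus\<close>.\<close>
  have "ell_plus \<gamma> < m"
    using nu_bounds(1)[OF l1 e] nu1_minus_eq(2)[OF ge e] e
    unfolding m_def by (simp add: eigenpair_def pos_less_divide_eq mult.commute)
  note m = lambda_plus_less_lambda_of[OF \<gamma> this] ell_of_lambda_of[OF \<gamma> this]
  show "lambda_plus \<gamma> < lambda_of m \<gamma>"
    by (fact m(1))
  show "eta_m lam lam1 \<gamma> = 1" if "lam < lambda_of m \<gamma>"
  proof (cases "lam > lambda_plus \<gamma>")
    case True
    then have "ell_of lam \<gamma> < m"
      \<comment> \<open>Monotonicity of \<open>ell_of\<close> carries the comparison with m over to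
        spikes, which selects the default value 1.\<close>
      using ell_of_strict_mono[OF True that] m(2) by simp
    then show ?thesis
      by (simp add: eta_m_def m_def Let_def)
  qed (simp add: eta_m_def)
qed

end

theorem theorem4p2p1:
  fixes \<gamma> :: real and r :: nat and ell :: "nat \<Rightarrow> real" and lam1 :: real
  assumes "\<gamma> > 0"
    and "r \<ge> 1"
    and "1 \<le> ell r"
    and "\<And>i. 1 \<le> i \<Longrightarrow> i < r \<Longrightarrow> ell (Suc i) < ell i"
    and "lam1 = lambda_of (ell 1) \<gamma>"
  shows
    "(\<forall>p>2 * r.
        is_arg_min (\<lambda>\<eta>. condition_number (asymp_pivot p r ell \<eta> \<gamma>))
          (\<lambda>\<eta>. \<forall>i\<in>{1..r}. 0 < \<eta> i)
          (\<lambda>i. eta_m (lambda_of (ell i) \<gamma>) lam1 \<gamma>))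
     \<and>
     (\<forall>p>2 * r.
        condition_number
          (asymp_pivot p r ell (\<lambda>i. eta_m (lambda_of (ell i) \<gamma>) lam1 \<gamma>) \<gamma>)
        = kappa1 (ell 1) \<gamma>)
     \<and>
     (ell 1 > ell1_plus \<gamma> \<longrightarrow>
        (\<forall>l\<ge>1.
           nu1_minus (ell 1) \<gamma> \<noteq> 1 / (coef_a l \<gamma> * l) \<and>
           eta_m (lambda_of l \<gamma>) lam1 \<gamma> =
             (if l > ell_m_plus (ell 1) \<gamma>
              then (nu1_minus (ell 1) \<gamma> - coef_b l \<gamma>)
                   / (coef_a l \<gamma> - 1 / (l * nu1_minus (ell 1) \<gamma>))
              else 1)))
     \<and>
     (\<forall>lam1' > lambda_plus \<gamma>.
        lambda_of (ell_m_plus (ell_of lam1' \<gamma>) \<gamma>) \<gamma> > lambda_plus \<gamma> \<and>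
        (\<exists>\<epsilon>>0. \<forall>lam<lambda_plus \<gamma> + \<epsilon>. eta_m lam lam1' \<gamma> = 1))"
proof -
  note \<gamma> = assms(1)
  have anti: "ell j \<le> ell i" if "1 \<le> i" "i \<le> j" "j \<le> r" for i j
    using that(2,3)
  proof (induction j rule: dec_induct)
    case (step n)
    then show ?case
      using assms(4)[of n] that(1) by simp
  qed simp
  have ell: "1 \<le> ell i \<and> ell i \<le> ell 1" if "i \<in> {1..r}" for i
    using anti[of i r] anti[of 1 i] that assms(3) by auto
  then have ge: "ell 1 \<ge> 1"
    using assms(2) by auto
  obtain \<nu> \<mu> where e: "eigenpair \<gamma> (ell 1) (eta1 (lambda_of (ell 1) \<gamma>) \<gamma>) \<nu> \<mu>"
    by (rule eigenpair_eta1_exists[OF \<gamma> ge])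
  note n = nu1_minus_eq[OF \<gamma> ge e]
  let ?\<eta> = "\<lambda>i. eta_m (lambda_of (ell i) \<gamma>) lam1 \<gamma>"
  have opt: "condition_number (asymp_pivot p r ell ?\<eta> \<gamma>) = \<mu> / \<nu>" if "p > 2 * r" for p
    unfolding assms(5) by (rule condition_number_pivot_eta_m[where ell = ell, OF \<gamma> that assms(2) ell e])
  have pos: "0 < ?\<eta> i" if "i \<in> {1..r}" for i
    using eta_m_eigenpair[OF \<gamma> ge e] ell[OF that] unfolding assms(5) by metis
  show ?thesis
  proof (intro conjI allI impI)
    fix p assume p: "p > 2 * r"
    have "\<mu> / \<nu> \<le> condition_number (asymp_pivot p r ell \<eta> \<gamma>)" if "\<forall>i\<in>{1..r}. 0 < \<eta> i" for \<eta>
      using condition_number_pivot_ge[where ell = ell, OF \<gamma> p assms(2) _ _ e] ell that by blast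
    then show "is_arg_min (\<lambda>\<eta>. condition_number (asymp_pivot p r ell \<eta> \<gamma>))
          (\<lambda>\<eta>. \<forall>i\<in>{1..r}. 0 < \<eta> i) ?\<eta>"
      \<comment> \<open>Besides minimality, feasibility is required: the shrinker itself is positive
        at each spike.\<close>
      unfolding is_arg_min_def opt[OF p] using pos by (blast dest: leD)
    show "condition_number (asymp_pivot p r ell ?\<eta> \<gamma>) = kappa1 (ell 1) \<gamma>"
      unfolding opt[OF p] kappa1_def eigenpair_A_mat(3)[OF \<gamma> ge e] ..
  next
    fix l :: real
    assume l1: "ell 1 > ell1_plus \<gamma>" and l: "l \<ge> 1"
    show "nu1_minus (ell 1) \<gamma> \<noteq> 1 / (coef_a l \<gamma> * l)"
      unfolding n using nu_coef_a_less[OF \<gamma> l1 e l] coef_pos(1)[OF \<gamma> l] l by auto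
    show "eta_m (lambda_of l \<gamma>) lam1 \<gamma> =
             (if l > ell_m_plus (ell 1) \<gamma>
              then (nu1_minus (ell 1) \<gamma> - coef_b l \<gamma>)
                   / (coef_a l \<gamma> - 1 / (l * nu1_minus (ell 1) \<gamma>))
              else 1)"
      unfolding assms(5) n by (rule eta_m_lambda_of[OF \<gamma> l1 e l])
  next
    fix lam1' assume lam1': "lam1' > lambda_plus \<gamma>"
    note bc = bulk_collapse[OF \<gamma> lam1']
    show "lambda_of (ell_m_plus (ell_of lam1' \<gamma>) \<gamma>) \<gamma> > lambda_plus \<gamma>"
      by (rule bc(1))
    show "\<exists>\<epsilon>>0. \<forall>lam<lambda_plus \<gamma> + \<epsilon>. eta_m lam lam1' \<gamma> = 1"
      \<comment> \<open>The width \<epsilon> is the whole gap between the bulk edge and the image of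
        the threshold.\<close>
      by (rule exI[of _ "lambda_of (ell_m_plus (ell_of lam1' \<gamma>) \<gamma>) \<gamma> - lambda_plus \<gamma>"])
        (use bc in auto)
  qed
qed

end
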